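(* Let $u\geq 1$ and let $\ell_1,\ldots,\ell_u\geq 3$ be integers (not necessarily distinct), and let $L=\{\ell_1,\ldots,\ell_u\}$ (as a multiset). Set $b=\sum_{i=1}^u \ell_i$, $b_0 = 2|L_0|\,(\max(L_0)+3)$ and $b_1 = 7^{|L_1|-1}(2\max(L_1)+1)$. Then $OP(y,\ell_1,\ldots,\ell_u)$ has a solution for every integer $y$ with \[ y \geq 3b + 24 b_0 + 28 b_1 + 119 . \]
   Context: For an integer $v\geq 3$, $K_v^*$ denotes the complete graph $K_v$ if $v$ is odd, and $K_v$ minus the edges of a $1$-factor (perfect matching) if $v$ is even. For a $2$-regular graph $F$ of order $v$, the Oberwolfach problem $OP(F)$ asks for a decomposition of the edge set of $K_v^*$ into spanning subgraphs each isomorphic to $F$ (a $2$-factorization of $K_v^*$ into copies of $F$); such a decomposition is called a solution to $OP(F)$. For integers $m_1,\ldots,m_s\geq 3$, $OP(m_1,\ldots,m_s)$ denotes $OP(F)$ where $F$ is a $2$-regular graph whose cycles have lengths exactly $m_1,\ldots,m_s$ (so its order is $\sum m_j$). For a multiset $L$ of positive integers, $L_0$ and $L_1$ denote the sub-multisets of even and odd elements respectively, $|L|$ denotes size counted with multiplicity, and by convention $\max(\varnothing)=0$. *)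

theory Defs
  imports Complex_Main "HOL-Library.Multiset"
begin

definition complete_edges :: "nat \<Rightarrow> nat set set" where
  "complete_edges v = {e. \<exists>x y. x < v \<and> y < v \<and> x \<noteq> y \<and> e = {x, y}}"

definition perfect_matching :: "nat \<Rightarrow> nat set set \<Rightarrow> bool" where
  "perfect_matching v I \<longleftrightarrow> I \<subseteq> complete_edges v \<and> (\<forall>x<v. \<exists>!e. e \<in> I \<and> x \<in> e)"

definition K_star :: "nat \<Rightarrow> nat set set \<Rightarrow> bool" where
  "K_star v E \<longleftrightarrow>
     (if odd v then E = complete_edges v
      else (\<exists>I. perfect_matching v I \<and> E = complete_edges v - I))"

definition cycle_edges :: "nat list \<Rightarrow> nat set set" where
  "cycle_edges xs = {{xs ! i, xs ! ((i + 1) mod length xs)} | i. i < length xs}"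

definition two_factor_of_type :: "nat \<Rightarrow> nat multiset \<Rightarrow> nat set set \<Rightarrow> bool" where
  "two_factor_of_type v M F \<longleftrightarrow>
     (\<exists>cs. (\<forall>c \<in> set cs. distinct c \<and> 3 \<le> length c)
        \<and> mset (map length cs) = M
        \<and> (\<forall>i < length cs. \<forall>j < length cs. i \<noteq> j \<longrightarrow> set (cs ! i) \<inter> set (cs ! j) = {})
        \<and> (\<Union>c \<in> set cs. set c) = {0..<v}
        \<and> F = (\<Union>c \<in> set cs. cycle_edges c))"

definition OP_solvable :: "nat multiset \<Rightarrow> bool" where
  "OP_solvable M \<longleftrightarrow>
     (let v = sum_mset M in
      \<exists>E S. K_star v E
        \<and> (\<forall>F \<in> S. two_factor_of_type v M F)
        \<and> (\<forall>A \<in> S. \<forall>B \<in> S. A \<noteq> B \<longrightarrow> A \<inter> B = {})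
        \<and> \<Union>S = E)"

definition mmax :: "nat multiset \<Rightarrow> nat" where
  "mmax M = (if M = {#} then 0 else Max (set_mset M))"

end

theory Submission
  imports Defs
begin

text \<open>
  Write \<open>v = y + b = 2n + 1 + \<delta>\<close> with \<open>\<delta> \<in> {0, 1}\<close>. We first colour the edges of \<open>K\<^sub>n\<close>, with vertex set
  \<open>\<int>\<^sub>n\<close>, by \<open>n\<close> colours that are translates of one base graph. Its cycles of lengths \<open>\<ell>\<^sub>1, \<dots>, \<ell>\<^sub>u\<close>, with
  pairwise distinct differences, are found greedily in the upper half of \<open>{0, \<dots>, n - 1}\<close>; a vertex has to
  avoid at most \<open>5b + 1\<close> places, so \<open>n \<ge> 10b + 6\<close> suffices. A path zigzagging in the lower half takes all
  the other differences, whatever they are.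

  The colouring of \<open>K\<^sub>n\<close> is then extended to \<open>K\<^sub>v\<close> by amalgamation and detachment. The missing
  \<open>k = v - n\<close> vertices are amalgamated into one, so that each colour consists of its short cycles and
  of \<open>k\<close> ears at the amalgamated vertex. One vertex at a time is split off: in each colour it takes
  ends of two different ears, which merges them, and it must become adjacent to each old vertex exactly
  once. Joining each ear to the places of its two ends and to \<open>k - 2\<close> dummies of its colour gives a
  regular bipartite multigraph, and a perfect matching in it is the required choice. At the end each
  colour has a single ear, which the last vertex closes to the long cycle.
\<close>

section \<open>Perfect matchings in regular bipartite multigraphs\<close>

text \<open>Induction on \<open>card A\<close> with two cases. A nonempty proper \<open>S\<close>
  with exactly \<open>card S\<close> neighbours splits the problem into \<open>S\<close> and
  \<open>A - S\<close>, the latter without the neighbours of \<open>S\<close>; adding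
  \<open>S\<close> to any \<open>T\<close> there shows that Hall's condition survives. Without such
  an \<open>S\<close> every nonempty proper subset has a spare neighbour, so any \<open>a\<close>
  may take any \<open>b\<close> from \<open>N a\<close>.\<close>

lemma hall_injection:
  fixes N :: "'a \<Rightarrow> 'b set"
  assumes "finite A" and "\<And>a. a \<in> A \<Longrightarrow> finite (N a)"
    and "\<And>S. S \<subseteq> A \<Longrightarrow> card S \<le> card (\<Union>(N ` S))"
  shows "\<exists>f. inj_on f A \<and> (\<forall>a\<in>A. f a \<in> N a)"
  using assms
proof (induction "card A" arbitrary: A N rule: less_induct)
  case less
  note fin = less.prems(1) and finN = less.prems(2) and hall = less.prems(3)
  have finU: "finite (\<Union>(N ` S))" if "S \<subseteq> A" for S
    using that fin finN by (auto intro!: finite_UN_I intro: finite_subset)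
  show ?case
  proof (cases "A = {}")
    case False
    show ?thesis
    proof (cases "\<exists>S. S \<subset> A \<and> S \<noteq> {} \<and> card S = card (\<Union>(N ` S))")
      case True
      then obtain S where S: "S \<subset> A" "S \<noteq> {}" "card S = card (\<Union>(N ` S))" by blast
      have finS: "finite S" using S fin finite_subset by blast
      have "\<exists>f. inj_on f S \<and> (\<forall>a\<in>S. f a \<in> N a)"
      proof (rule less.hyps)
        show "card S < card A" using S fin by (intro psubset_card_mono) auto
      qed (use S finS finN hall in auto)
      then obtain f where f: "inj_on f S" "\<forall>a\<in>S. f a \<in> N a" by blast
      let ?N = "\<lambda>a. N a - \<Union>(N ` S)"
      have "\<exists>g. inj_on g (A - S) \<and> (\<forall>a\<in>A - S. g a \<in> ?N a)"
      proof (rule less.hyps)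
        show "card (A - S) < card A" using S fin by (intro psubset_card_mono) auto
        show "finite (A - S)" using fin by simp
        show "finite (?N a)" if "a \<in> A - S" for a using that finN by simp
        fix T assume T: "T \<subseteq> A - S"
        have "card T + card S = card (T \<union> S)"
          using T finS fin by (intro card_Un_disjoint[symmetric]) (auto intro: finite_subset)
        also have "\<dots> \<le> card (\<Union>(N ` (T \<union> S)))" using T S by (intro hall) auto
        also have "\<Union>(N ` (T \<union> S)) = \<Union>(?N ` T) \<union> \<Union>(N ` S)" by auto
        also have "card \<dots> \<le> card (\<Union>(?N ` T)) + card (\<Union>(N ` S))" by (rule card_Un_le)
        finally show "card T \<le> card (\<Union>(?N ` T))" using S by simp
      qed
      then obtain g where g: "inj_on g (A - S)" "\<forall>a\<in>A - S. g a \<in> ?N a" by blast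
      let ?h = "\<lambda>a. if a \<in> S then f a else g a"
      have "inj_on ?h A"
      proof (rule inj_onI)
        fix a b assume ab: "a \<in> A" "b \<in> A" "?h a = ?h b"
        have sep: "f c \<noteq> g d" if "c \<in> S" "d \<in> A - S" for c d
        proof -
          have "f c \<in> \<Union>(N ` S)" using bspec[OF f(2) that(1)] that(1) by (rule UN_I[rotated])
          moreover have "g d \<notin> \<Union>(N ` S)" using bspec[OF g(2) that(2)] by simp
          ultimately show ?thesis by metis
        qed
        consider "a \<in> S" "b \<in> S" | "a \<in> S" "b \<notin> S" | "a \<notin> S" "b \<in> S" | "a \<notin> S" "b \<notin> S" by blast
        then show "a = b"
        proof cases
          case 1 then show ?thesis using ab f(1) by (simp add: inj_onD)
        next
          case 2 then show ?thesis using ab sep[of a b] by simp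
        next
          case 3 then show ?thesis using ab sep[of b a] by simp
        next
          case 4 then show ?thesis using ab g(1) by (simp add: inj_onD)
        qed
      qed
      moreover have "\<forall>a\<in>A. ?h a \<in> N a" using f g by auto
      ultimately show ?thesis by blast
    next
      case noTight: False
      obtain a where a: "a \<in> A" using False by blast
      have "card {a} \<le> card (\<Union>(N ` {a}))" using a by (intro hall) auto
      then obtain b where b: "b \<in> N a" by fastforce
      let ?N = "\<lambda>x. N x - {b}"
      have "\<exists>g. inj_on g (A - {a}) \<and> (\<forall>x\<in>A - {a}. g x \<in> ?N x)"
      proof (rule less.hyps)
        show "card (A - {a}) < card A" using a fin by (intro psubset_card_mono) auto
        show "finite (A - {a})" using fin by simp
        show "finite (?N x)" if "x \<in> A - {a}" for x using that finN by simp
        fix T assume T: "T \<subseteq> A - {a}"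
        show "card T \<le> card (\<Union>(?N ` T))"
        proof (cases "T = {}")
          case False
          have "card T < card (\<Union>(N ` T))"
            using hall[of T] noTight T a False by (metis Diff_iff antisym_conv2 insertCI psubsetI subset_Diff_insert subset_eq)
          moreover have "\<Union>(?N ` T) = \<Union>(N ` T) - {b}" by auto
          ultimately show ?thesis using finU[of T] T by (auto simp: card_Diff_singleton_if)
        qed simp
      qed
      then obtain g where g: "inj_on g (A - {a})" "\<forall>x\<in>A - {a}. g x \<in> ?N x" by blast
      have "inj_on (g(a := b)) A"
        using g by (auto simp: inj_on_def)
      moreover have "\<forall>x\<in>A. (g(a := b)) x \<in> N x" using g b by auto
      ultimately show ?thesis by blast
    qed
  qed auto
qed

text \<open>The numbers \<open>w a b\<close> are edge multiplicities. All the weight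
  \<open>card S * r\<close> leaving \<open>S\<close> arrives at its neighbours, which can absorb
  only \<open>r\<close> each; this gives Hall's condition. Counting the whole weight twice gives
  \<open>card A = card B\<close>, so the injection is onto.\<close>

lemma regular_bipartite_perfect_matching:
  fixes w :: "'a \<Rightarrow> 'b \<Rightarrow> nat"
  assumes "finite A" "finite B" "0 < r"
    and row: "\<And>a. a \<in> A \<Longrightarrow> (\<Sum>b\<in>B. w a b) = r"
    and col: "\<And>b. b \<in> B \<Longrightarrow> (\<Sum>a\<in>A. w a b) = r"
  obtains f where "bij_betw f A B" "\<And>a. a \<in> A \<Longrightarrow> 0 < w a (f a)"
proof -
  let ?N = "\<lambda>a. {b \<in> B. 0 < w a b}"
  have "\<exists>f. inj_on f A \<and> (\<forall>a\<in>A. f a \<in> ?N a)"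
  proof (rule hall_injection)
    fix S assume S: "S \<subseteq> A"
    let ?U = "\<Union>(?N ` S)"
    have "card S * r = (\<Sum>a\<in>S. \<Sum>b\<in>B. w a b)" using S row by (simp add: subset_eq)
    also have "\<dots> = (\<Sum>a\<in>S. \<Sum>b\<in>?U. w a b)"
      using assms(2) by (intro sum.cong[OF refl] sum.mono_neutral_right) auto
    also have "\<dots> \<le> (\<Sum>a\<in>A. \<Sum>b\<in>?U. w a b)" using S assms(1) by (intro sum_mono2) auto
    also have "\<dots> = (\<Sum>b\<in>?U. \<Sum>a\<in>A. w a b)" by (rule sum.swap)
    also have "\<dots> = card ?U * r" using col by simp
    finally show "card S \<le> card ?U" using assms(3) by simp
  qed (use assms in auto)
  then obtain f where f: "inj_on f A" "\<forall>a\<in>A. f a \<in> ?N a" by blast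
  have "card A * r = (\<Sum>a\<in>A. \<Sum>b\<in>B. w a b)" using row by simp
  also have "\<dots> = (\<Sum>b\<in>B. \<Sum>a\<in>A. w a b)" by (rule sum.swap)
  also have "\<dots> = card B * r" using col by simp
  finally have "card A = card B" using assms(3) by simp
  then have "f ` A = B" using f assms by (intro card_subset_eq) (auto simp: card_image)
  then show thesis using f that by (auto simp: bij_betw_def)
qed

section \<open>Edge multisets of paths and cycles\<close>

text \<open>Multisets instead of sets let a single equation with
  \<open>mset_set (complete_edges s)\<close> say both that every edge is covered and that none is
  used twice.\<close>

fun path_edges :: "'a list \<Rightarrow> 'a set multiset" where
  "path_edges (x # y # r) = add_mset {x, y} (path_edges (y # r))"
| "path_edges _ = {#}"

definition closed_edges :: "'a list \<Rightarrow> 'a set multiset" where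
  "closed_edges c = add_mset {last c, hd c} (path_edges c)"

definition incidence :: "'a \<Rightarrow> 'a set multiset \<Rightarrow> nat" where
  "incidence x E = size {#e \<in># E. x \<in> e#}"

text \<open>A one-vertex list has its vertex as both ends, so degree in the path plus number of ends
  is 2 at every vertex of the path. For an ear the ends are where its edges to the amalgamated
  vertex attach.\<close>

definition ends :: "'a list \<Rightarrow> 'a multiset" where
  "ends p = (if p = [] then {#} else {#hd p, last p#})"

lemma incidence_simps [simp]:
  "incidence x {#} = 0"
  "incidence x (add_mset e E) = of_bool (x \<in> e) + incidence x E"
  "incidence x (E + F) = incidence x E + incidence x F"
  by (auto simp: incidence_def)

lemma incidence_sum [simp]: "incidence x (\<Sum>i\<in>A. E i) = (\<Sum>i\<in>A. incidence x (E i))"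
  by (induction A rule: infinite_finite_induct) auto

lemma incidence_sum_mset [simp]:
  "incidence x (\<Sum>i\<in>#A. E i) = (\<Sum>i\<in>#A. incidence x (E i))"
  by (induction A) auto

lemma incidence_eq_0_iff: "incidence x E = 0 \<longleftrightarrow> (\<forall>e\<in>#E. x \<notin> e)"
  by (auto simp: incidence_def)

lemma incidence_path_edges:
  "distinct p \<Longrightarrow> incidence x (path_edges p) + count (ends p) x = 2 * count (mset p) x"
proof (induction p rule: path_edges.induct)
  case (1 a b r)
  then have "incidence x (path_edges (b # r)) + count (ends (b # r)) x = 2 * count (mset (b # r)) x"
    by simp
  with 1(2) show ?case by (auto simp: ends_def split: if_splits)
qed (auto simp: ends_def)

lemma incidence_closed_edges:
  assumes "distinct c" "2 \<le> length c"
  shows "incidence x (closed_edges c) = 2 * count (mset c) x"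
proof -
  obtain a b r where c: "c = a # b # r" using assms(2)
    by (metis One_nat_def Suc_1 Suc_le_length_iff)
  have "last c \<noteq> hd c" using assms(1) c by auto
  then have "incidence x (closed_edges c) = count (ends c) x + incidence x (path_edges c)"
    using c by (auto simp: closed_edges_def ends_def)
  then show ?thesis using incidence_path_edges[OF assms(1), of x] by simp
qed

lemma path_edges_append: "path_edges (xs @ z # ys) = path_edges (xs @ [z]) + path_edges (z # ys)"
  by (induction xs rule: path_edges.induct) auto

lemma path_edges_snoc: "p \<noteq> [] \<Longrightarrow> path_edges (p @ [z]) = add_mset {last p, z} (path_edges p)"
  by (induction p rule: path_edges.induct) auto

lemma path_edges_rev: "path_edges (rev p) = path_edges p"
proof (induction p rule: path_edges.induct)
  case (1 x y r)
  have "path_edges (rev (x # y # r)) = path_edges (rev (y # r) @ [x])" by simp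
  also have "\<dots> = add_mset {y, x} (path_edges (rev (y # r)))"
    by (subst path_edges_snoc) auto
  finally show ?case using 1 by (simp add: insert_commute)
qed auto

lemma set_path_edges: "set_mset (path_edges p) = {{p ! i, p ! Suc i} | i. Suc i < length p}"
proof (induction p rule: path_edges.induct)
  case (1 x y r)
  have "{{(x # y # r) ! i, (x # y # r) ! Suc i} |i. Suc i < length (x # y # r)}
     = insert {x, y} {{(y # r) ! i, (y # r) ! Suc i} |i. Suc i < length (y # r)}" (is "?A = ?B")
  proof (intro equalityI subsetI)
    fix e assume "e \<in> ?A"
    then obtain i where i: "Suc i < length (x # y # r)" "e = {(x # y # r) ! i, (x # y # r) ! Suc i}"
      by blast
    then show "e \<in> ?B" by (cases i) auto
  next
    fix e assume "e \<in> ?B"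
    then consider "e = {x, y}"
      | i where "Suc i < length (y # r)" "e = {(y # r) ! i, (y # r) ! Suc i}" by blast
    then show "e \<in> ?A"
    proof cases
      case 1 then show ?thesis by (intro CollectI exI[of _ 0]) auto
    next
      case (2 i) then show ?thesis by (intro CollectI exI[of _ "Suc i"]) auto
    qed
  qed
  then show ?case using 1 by simp
qed auto

lemma set_closed_edges:
  assumes "c \<noteq> []"
  shows "set_mset (closed_edges c) = cycle_edges c"
proof -
  have "cycle_edges c = insert {last c, hd c} {{c ! i, c ! Suc i} | i. Suc i < length c}" (is "_ = ?B")
  proof (intro equalityI subsetI)
    fix e assume "e \<in> cycle_edges c"
    then obtain i where i: "i < length c" "e = {c ! i, c ! ((i + 1) mod length c)}"
      by (auto simp: cycle_edges_def)
    show "e \<in> ?B"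
    proof (cases "Suc i = length c")
      case True
      then have "e = {last c, hd c}" using i assms by (simp add: last_conv_nth hd_conv_nth flip: True)
      then show ?thesis by simp
    next
      case False
      then have "Suc i < length c" using i by simp
      then show ?thesis using i by auto
    qed
  next
    fix e assume "e \<in> ?B"
    then consider "e = {last c, hd c}" | i where "Suc i < length c" "e = {c ! i, c ! Suc i}" by blast
    then show "e \<in> cycle_edges c"
    proof cases
      case 1 then show ?thesis using assms unfolding cycle_edges_def
        by (intro CollectI exI[of _ "length c - 1"]) (auto simp: last_conv_nth hd_conv_nth)
    next
      case (2 i) then show ?thesis unfolding cycle_edges_def
        by (intro CollectI exI[of _ i]) auto
    qed
  qed
  then show ?thesis by (simp add: closed_edges_def set_path_edges)
qed

section \<open>Edges of the complete graph\<close>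

lemma finite_complete_edges [simp]: "finite (complete_edges s)"
  by (rule finite_subset[of _ "Pow {..<s}"]) (auto simp: complete_edges_def)

text \<open>The added star is exactly what a detachment step has to produce, one edge from the new
  vertex to each old one.\<close>

lemma complete_edges_Suc:
  "mset_set (complete_edges (Suc s)) = mset_set (complete_edges s) + (\<Sum>x<s. {#{x, s}#})"
proof -
  have eq: "complete_edges (Suc s) = complete_edges s \<union> (\<lambda>x. {x, s}) ` {..<s}"
    unfolding complete_edges_def by (auto simp: less_Suc_eq) 
  have inj: "inj_on (\<lambda>x. {x, s}) {..<s}" by (auto simp: inj_on_def doubleton_eq_iff)
  have "complete_edges s \<inter> (\<lambda>x. {x, s}) ` {..<s} = {}"
    unfolding complete_edges_def by (auto simp: doubleton_eq_iff)
  then have "mset_set (complete_edges (Suc s)) = mset_set (complete_edges s) + mset_set ((\<lambda>x. {x, s}) ` {..<s})"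
    unfolding eq by (intro mset_set_Union) auto
  also have "mset_set ((\<lambda>x. {x, s}) ` {..<s}) = (\<Sum>x<s. {#{x, s}#})"
    using inj by (simp add: image_mset_mset_set[symmetric] sum_unfold_sum_mset)
  finally show ?thesis .
qed

lemma incidence_complete_edges:
  "x < s \<Longrightarrow> incidence x (mset_set (complete_edges s)) = s - 1"
proof (induction s)
  case (Suc s)
  have *: "(\<Sum>y<s. of_bool (x = y \<or> x = s)) = (if x = s then s else (1::nat))" if "x \<le> s"
  proof (cases "x = s")
    case False
    then have "(\<Sum>y<s. of_bool (x = y \<or> x = s)) = (\<Sum>y<s. if x = y then 1 else (0::nat))"
      by (intro sum.cong) auto
    then show ?thesis using that False by simp
  qed simp
  have 0: "incidence s (mset_set (complete_edges s)) = 0"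
    by (auto simp: incidence_eq_0_iff complete_edges_def)
  show ?case
    using Suc * 0 by (auto simp: complete_edges_Suc less_Suc_eq)
qed simp

section \<open>Amalgamated vertices and their ears\<close>

text \<open>In the finished 1-factor these vertices get partners among the vertices that are still
  amalgamated.\<close>

definition unmatched :: "nat \<Rightarrow> nat set multiset \<Rightarrow> nat set" where
  "unmatched s M = {x. x < s \<and> incidence x M = 0}"

text \<open>The vertices below \<open>s\<close> are already detached and \<open>k\<close> vertices are still amalgamated. In colour
  \<open>i < n\<close>, \<open>C i\<close> lists the short cycles and \<open>P i\<close> the \<open>k\<close> ears, each given by its detached vertices
  in order, so that a loop is the empty list. \<open>M q\<close>, for \<open>q < \<delta>\<close>, is a partial 1-factor; the parity
  condition says that the number of ends of its loops is even. The edges from detached vertices to the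
  amalgamated one are determined by these data and are not recorded.\<close>
definition outline ::
  "nat multiset \<Rightarrow> nat \<Rightarrow> nat \<Rightarrow> nat \<Rightarrow> nat \<Rightarrow> (nat \<Rightarrow> nat list list) \<Rightarrow> (nat \<Rightarrow> nat list list)
    \<Rightarrow> (nat \<Rightarrow> nat set multiset) \<Rightarrow> bool" where
  "outline L n \<delta> s k C P M \<longleftrightarrow>
     s + k = 2 * n + \<delta> + 1
     \<and> (\<forall>i<n. mset (map length (C i)) = L \<and> length (P i) = k
           \<and> mset (concat (C i)) + mset (concat (P i)) = mset_set {..<s})
     \<and> (\<forall>q<\<delta>. (\<forall>x. incidence x (M q) \<le> 1)
           \<and> card (unmatched s (M q)) \<le> k \<and> even (k + card (unmatched s (M q))))
     \<and> (\<Sum>i<n. (\<Sum>c\<in>#mset (C i). closed_edges c) + (\<Sum>p\<in>#mset (P i). path_edges p))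
         + (\<Sum>q<\<delta>. M q) = mset_set (complete_edges s)"

lemma mset_eq_distinct:
  fixes s :: nat
  assumes "mset xs = mset_set {..<s}"
  shows "distinct xs"
proof -
  have "mset xs = mset [0..<s]" using assms by (simp add: lessThan_atLeast0)
  then show ?thesis by (metis distinct_upt mset_eq_imp_distinct_iff)
qed

lemma finite_unmatched [simp]: "finite (unmatched s M)"
  by (auto simp: unmatched_def)

lemma outline_lists:
  assumes "outline L n \<delta> s k C P M" "i < n"
  shows "distinct (concat (C i))" "distinct (concat (P i))"
    and "set (concat (C i)) \<union> set (concat (P i)) = {..<s}"
proof -
  have eq: "mset (concat (C i) @ concat (P i)) = mset_set {..<s}"
    using assms by (auto simp: outline_def)
  then show "distinct (concat (C i))" "distinct (concat (P i))"
    using mset_eq_distinct[OF eq] by auto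
  have "set_mset (mset (concat (C i) @ concat (P i))) = {..<s}" using eq by simp
  then show "set (concat (C i)) \<union> set (concat (P i)) = {..<s}" by simp
qed

lemma distinct_concat_member: "distinct (concat xs) \<Longrightarrow> x \<in> set xs \<Longrightarrow> distinct x"
  by (induction xs) auto

lemma sum_mset_count_concat: "(\<Sum>c\<in>#mset xs. 2 * count (mset c) x) = 2 * count (mset (concat xs)) x"
  by (induction xs) auto

text \<open>The left side counts the edges from \<open>x\<close> to the amalgamated vertex, so there
  is one for each of its \<open>k\<close> vertices. Degree plus ends is 2 in every colour, and
  incidence plus \<open>of_bool\<close> is 1 in every 1-factor; of the resulting
  \<open>2 * n + \<delta>\<close>, the recorded edges account for \<open>s - 1\<close>.\<close>

lemma outline_ends:
  assumes out: "outline L n \<delta> s k C P M" and L: "\<forall>l\<in>#L. 3 \<le> l" and x: "x < s"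
  shows "(\<Sum>i<n. \<Sum>p\<in>#mset (P i). count (ends p) x) + (\<Sum>q<\<delta>. of_bool (x \<in> unmatched s (M q))) = k"
proof -
  have sk: "s + k = 2 * n + \<delta> + 1" using out by (simp add: outline_def)
  have "incidence x ((\<Sum>i<n. (\<Sum>c\<in>#mset (C i). closed_edges c) + (\<Sum>p\<in>#mset (P i). path_edges p))
         + (\<Sum>q<\<delta>. M q)) = s - 1"
    using out x by (simp add: outline_def incidence_complete_edges)
  then have deg: "(\<Sum>i<n. (\<Sum>c\<in>#mset (C i). incidence x (closed_edges c))
       + (\<Sum>p\<in>#mset (P i). incidence x (path_edges p))) + (\<Sum>q<\<delta>. incidence x (M q)) = s - 1" by simp
  have "(\<Sum>c\<in>#mset (C i). incidence x (closed_edges c)) + (\<Sum>p\<in>#mset (P i). incidence x (path_edges p))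
      + (\<Sum>p\<in>#mset (P i). count (ends p) x) = 2" if i: "i < n" for i
  proof -
    have C: "mset (map length (C i)) = L"
      and V: "mset (concat (C i)) + mset (concat (P i)) = mset_set {..<s}"
      using out i by (auto simp: outline_def)
    note d = outline_lists[OF out i]
    have "(\<Sum>c\<in>#mset (C i). incidence x (closed_edges c)) = (\<Sum>c\<in>#mset (C i). 2 * count (mset c) x)"
    proof (intro arg_cong[of _ _ sum_mset] image_mset_cong)
      fix c assume c: "c \<in># mset (C i)"
      have "length c \<in># mset (map length (C i))" using c by simp
      then have "3 \<le> length c" using L C by blast
      then show "incidence x (closed_edges c) = 2 * count (mset c) x"
        using c d(1) by (intro incidence_closed_edges) (auto intro: distinct_concat_member)
    qed
    moreover have "(\<Sum>p\<in>#mset (P i). incidence x (path_edges p)) + (\<Sum>p\<in>#mset (P i). count (ends p) x)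
        = (\<Sum>p\<in>#mset (P i). 2 * count (mset p) x)"
      unfolding sum_mset.distrib[symmetric]
      using d(2) by (intro arg_cong[of _ _ sum_mset] image_mset_cong incidence_path_edges)
        (auto intro: distinct_concat_member)
    moreover have "count (mset (concat (C i))) x + count (mset (concat (P i))) x = 1"
      using V x by (metis count_mset_set(1) count_union finite_lessThan lessThan_iff)
    ultimately show ?thesis unfolding sum_mset_count_concat by simp
  qed
  then have 1: "(\<Sum>i<n. (\<Sum>c\<in>#mset (C i). incidence x (closed_edges c)) + (\<Sum>p\<in>#mset (P i). incidence x (path_edges p))
      + (\<Sum>p\<in>#mset (P i). count (ends p) x)) = 2 * n" by simp
  have "incidence x (M q) + of_bool (x \<in> unmatched s (M q)) = 1" if "q < \<delta>" for q
  proof -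
    have "incidence x (M q) \<le> 1" using out that by (auto simp: outline_def)
    then show ?thesis using x by (auto simp: unmatched_def)
  qed
  then have 2: "(\<Sum>q<\<delta>. incidence x (M q) + of_bool (x \<in> unmatched s (M q))) = \<delta>" by simp
  show ?thesis using 1 2 deg sk x by (simp add: sum.distrib)
qed

text \<open>\<open>g\<close> is the edge that arises when one end of the ear \<open>A\<close> is moved to the detached vertex \<open>s\<close>; moving
  one end of a loop creates no edge between \<open>s\<close> and an older vertex.\<close>
definition ear_end :: "'a \<Rightarrow> 'a list \<Rightarrow> 'a set multiset \<Rightarrow> bool" where
  "ear_end s A g \<longleftrightarrow> (A = [] \<and> g = {#}) \<or> (\<exists>x\<in>#ends A. g = {#{x, s}#})"

lemma ear_end_orient:
  assumes "ear_end s A g"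
  shows "\<exists>A'. mset A' = mset A \<and> path_edges (A' @ [s]) = path_edges A + g"
  using assms unfolding ear_end_def
proof (elim disjE bexE conjE)
  fix x assume x: "x \<in># ends A" and g: "g = {#{x, s}#}"
  then have A: "A \<noteq> []" by (auto simp: ends_def)
  then consider "x = last A" | "x = hd A" using x by (auto simp: ends_def)
  then show ?thesis
  proof cases
    case 1 then show ?thesis using A g by (intro exI[of _ A]) (simp add: path_edges_snoc)
  next
    case 2 then show ?thesis using A g
      by (intro exI[of _ "rev A"]) (simp add: path_edges_snoc path_edges_rev last_rev)
  qed
qed simp

text \<open>Each ear is turned so that its moved end comes last, and the two are joined through
  \<open>s\<close>. A loop contributes the empty list, so merging two loops gives the ear
  \<open>[s]\<close>.\<close>

lemma merge_ears:
  assumes "ear_end s A g" "ear_end s B h"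
  shows "\<exists>Z. mset Z = add_mset s (mset A + mset B)
           \<and> path_edges Z = path_edges A + path_edges B + (g + h)"
proof -
  obtain A' B' where A': "mset A' = mset A" "path_edges (A' @ [s]) = path_edges A + g"
    and B': "mset B' = mset B" "path_edges (B' @ [s]) = path_edges B + h"
    using assms[THEN ear_end_orient] by blast
  have "path_edges (s # rev B') = path_edges (B' @ [s])"
    using path_edges_rev[of "B' @ [s]"] by simp
  then have "path_edges (A' @ s # rev B') = path_edges A + path_edges B + (g + h)"
    using A' B' by (subst path_edges_append) simp
  then show ?thesis using A' B' by (intro exI[of _ "A' @ s # rev B'"]) simp
qed

text \<open>Positions are used rather than entries because several ears of a colour can be the empty
  list.\<close>

lemma mset_two_positions:
  assumes "a < length xs" "b < length xs" "a \<noteq> b"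
  obtains ys where "mset xs = add_mset (xs ! a) (add_mset (xs ! b) (mset ys))"
proof -
  have "mset xs = image_mset ((!) xs) (mset_set {..<length xs})"
    by (metis mset_map mset_upt map_nth lessThan_atLeast0)
  also have "{..<length xs} = insert a (insert b ({..<length xs} - {a, b}))" using assms by auto
  finally have "mset xs = add_mset (xs ! a) (add_mset (xs ! b)
      (image_mset ((!) xs) (mset_set ({..<length xs} - {a, b}))))"
    using assms by simp
  then show thesis using that ex_mset by metis
qed

text \<open>\<open>J\<close> holds the two ears that give an end to \<open>s\<close>. Their merger
  replaces both, so the number of ears drops by one.\<close>

lemma detach_colour:
  assumes "length P = k" "J \<subseteq> {..<k}" "card J = 2"
    and "\<And>j. j \<in> J \<Longrightarrow> ear_end s (P ! j) (g j)"
    and "\<And>j. j < k \<Longrightarrow> j \<notin> J \<Longrightarrow> g j = {#}"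
  shows "\<exists>P'. length P' = k - 1 \<and> mset (concat P') = add_mset s (mset (concat P))
     \<and> (\<Sum>p\<in>#mset P'. path_edges p) = (\<Sum>p\<in>#mset P. path_edges p) + (\<Sum>j<k. g j)"
proof -
  obtain a b where J: "J = {a, b}" "a \<noteq> b" using assms(3) by (meson card_2_iff)
  then obtain R where R: "mset P = add_mset (P ! a) (add_mset (P ! b) (mset R))"
    using mset_two_positions[of a P b] assms by auto
  have len: "k = length R + 2" using R assms(1) by (metis add_2_eq_Suc' size_add_mset size_mset)
  obtain Z where Z: "mset Z = add_mset s (mset (P ! a) + mset (P ! b))"
    "path_edges Z = path_edges (P ! a) + path_edges (P ! b) + (g a + g b)"
    using merge_ears[of s "P ! a" "g a" "P ! b" "g b"] assms(4) J by auto
  have conc: "mset (concat xs) = (\<Sum>x\<in>#mset xs. mset x)" for xs :: "'a list list"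
    by (induction xs) auto
  have "(\<Sum>j<k. g j) = (\<Sum>j\<in>J. g j)"
    using assms by (intro sum.mono_neutral_right) auto
  also have "\<dots> = g a + g b" using J by simp
  finally have "(\<Sum>p\<in>#mset (Z # R). path_edges p) = (\<Sum>p\<in>#mset P. path_edges p) + (\<Sum>j<k. g j)"
    using Z R by simp
  moreover have "mset (concat (Z # R)) = add_mset s (mset (concat P))"
    unfolding conc R using Z by simp
  ultimately show ?thesis using len by (intro exI[of _ "Z # R"]) simp
qed

lemma sum_mset_nth: "(\<Sum>p\<in>#mset xs. f p) = (\<Sum>j<length xs. f (xs ! j))"
proof -
  have "(\<Sum>p\<in>#mset xs. f p) = sum_list (map f xs)"
    by (simp add: sum_mset_sum_list flip: mset_map)
  then show ?thesis by (simp add: sum_list_sum_nth atLeast0LessThan)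
qed

lemma sum_count_lessThan:
  fixes s :: nat
  assumes "set_mset A \<subseteq> {..<s}"
  shows "(\<Sum>x<s. count A x) = size A"
  unfolding size_multiset_overloaded_eq
  using assms by (intro sum.mono_neutral_right) (auto simp: count_eq_zero_iff)

lemma sum_of_bool_lessThan: "(\<Sum>x<s. of_bool (x \<in> unmatched s M)) = card (unmatched s M)"
proof -
  have "(\<Sum>x<s. of_bool (x \<in> unmatched s M)) = (\<Sum>x\<in>unmatched s M. 1::nat)"
    by (intro sum.mono_neutral_cong_right) (auto simp: unmatched_def)
  then show ?thesis by simp
qed

section \<open>Detaching a vertex\<close>

lemma outline_detach:
  assumes out: "outline L n \<delta> s k C P M" and L: "\<forall>l\<in>#L. 3 \<le> l" and k: "2 \<le> k"
  shows "\<exists>P' M'. outline L n \<delta> (Suc s) (k - 1) C P' M'"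
proof -
  let ?U = "\<lambda>q. unmatched s (M q)"
  \<comment> \<open>One side consists of the ears of all colours and the 1-factors, the other of the
    old vertices, the nodes for the remaining amalgamated vertices, and the dummies. An ear matched
    to a dummy stays unchanged, so \<open>k - 2\<close> dummies per colour leave exactly two active
    ears.\<close>
  define A where "A = ({..<n} \<times> {..<k}) <+> {..<\<delta>}"
  define B where "B = {..<s} <+> ({..<k - 1} <+> ({..<n} \<times> {..<k - 2}))"
  \<comment> \<open>All degrees are multiplied by \<open>k - 1\<close>, so that the ends of loops can be spread evenly over the
    \<open>k - 1\<close> nodes \<open>Inr (Inl t)\<close>, which stand for the edges to the remaining amalgamated vertices.\<close>
  define w where "w a b = (case a of
      Inl (i, j) \<Rightarrow> (case b of Inl x \<Rightarrow> (k - 1) * count (ends (P i ! j)) x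
        | Inr (Inl t) \<Rightarrow> if P i ! j = [] then 2 else 0
        | Inr (Inr (i', t)) \<Rightarrow> if i = i' then k - 1 else 0)
    | Inr q \<Rightarrow> (case b of Inl x \<Rightarrow> (k - 1) * of_bool (x \<in> ?U q)
        | Inr (Inl t) \<Rightarrow> k - card (?U q)
        | Inr (Inr _) \<Rightarrow> 0))" for a :: "nat \<times> nat + nat" and b :: "nat + nat + nat \<times> nat"
  have w_simps [simp]:
    "w (Inl (i, j)) (Inl x) = (k - 1) * count (ends (P i ! j)) x"
    "w (Inl (i, j)) (Inr (Inl t)) = (if P i ! j = [] then 2 else 0)"
    "w (Inl (i, j)) (Inr (Inr (i', t))) = (if i = i' then k - 1 else 0)"
    "w (Inr q) (Inl x) = (k - 1) * of_bool (x \<in> ?U q)"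
    "w (Inr q) (Inr (Inl t)) = k - card (?U q)"
    "w (Inr q) (Inr (Inr z)) = 0" for i j x t i' q z
    by (auto simp: w_def)
  have sumA: "sum f A = (\<Sum>i<n. \<Sum>j<k. f (Inl (i, j))) + (\<Sum>q<\<delta>. f (Inr q))"
    for f :: "_ \<Rightarrow> 'b :: comm_monoid_add"
    unfolding A_def by (simp add: sum.Plus sum.cartesian_product comp_def case_prod_beta)
  have sumB: "sum f B = (\<Sum>x<s. f (Inl x)) + ((\<Sum>t<k - 1. f (Inr (Inl t)))
      + (\<Sum>i<n. \<Sum>t<k - 2. f (Inr (Inr (i, t)))))"
    for f :: "_ \<Rightarrow> 'b :: comm_monoid_add"
    unfolding B_def by (simp add: sum.Plus sum.cartesian_product comp_def case_prod_beta)
  have sk: "s + k = 2 * n + \<delta> + 1"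
    and edges: "(\<Sum>i<n. (\<Sum>c\<in>#mset (C i). closed_edges c) + (\<Sum>p\<in>#mset (P i). path_edges p))
         + (\<Sum>q<\<delta>. M q) = mset_set (complete_edges s)"
    using out by (auto simp: outline_def)
  have P: "length (P i) = k" "mset (map length (C i)) = L"
    "mset (concat (C i)) + mset (concat (P i)) = mset_set {..<s}" if "i < n" for i
    using out that by (auto simp: outline_def)
  have M: "\<And>x. incidence x (M q) \<le> 1" "card (?U q) \<le> k" "even (k + card (?U q))" if "q < \<delta>" for q
    using out that by (auto simp: outline_def)
  have ends_vertices: "set_mset (ends (P i ! j)) \<subseteq> {..<s}" if "i < n" "j < k" for i j
  proof -
    have "set (P i ! j) \<subseteq> {..<s}"
      using outline_lists(3)[OF out that(1)] nth_mem[of j "P i"] that P(1) by (auto simp: subset_iff)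
    then show ?thesis by (auto simp: ends_def subset_iff)
  qed
  have ends_sum: "(\<Sum>x<s. count (ends (P i ! j)) x) + 2 * of_bool (P i ! j = []) = 2"
    if "i < n" "j < k" for i j
    using sum_count_lessThan[OF ends_vertices[OF that]] by (auto simp: ends_def)
  have ends_total: "(\<Sum>i<n. \<Sum>j<k. count (ends (P i ! j)) x) + (\<Sum>q<\<delta>. of_bool (x \<in> ?U q)) = k"
    if "x < s" for x
    using outline_ends[OF out L that] P(1) by (simp add: sum_mset_nth)
  \<comment> \<open>This is the number of loop ends at the amalgamated vertex, twice the number of
    edges of the complete graph on \<open>k\<close> vertices. It is what remains of the
    \<open>2 * n * k + \<delta> * k\<close> ends in total after \<open>k\<close> of them have gone
    to each of the \<open>s\<close> old vertices. It gives the column sums at the nodes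
    \<open>Inr (Inl t)\<close>.\<close>
  have loops: "(\<Sum>i<n. \<Sum>j<k. 2 * of_bool (P i ! j = [])) + (\<Sum>q<\<delta>. k - card (?U q)) = k * (k - 1)"
  proof -
    have "k * s = (\<Sum>x<s. (\<Sum>i<n. \<Sum>j<k. count (ends (P i ! j)) x) + (\<Sum>q<\<delta>. of_bool (x \<in> ?U q)))"
      using ends_total by simp
    also have "\<dots> = (\<Sum>x<s. \<Sum>i<n. \<Sum>j<k. count (ends (P i ! j)) x) + (\<Sum>x<s. \<Sum>q<\<delta>. of_bool (x \<in> ?U q))"
      by (rule sum.distrib)
    also have "(\<Sum>x<s. \<Sum>i<n. \<Sum>j<k. count (ends (P i ! j)) x) = (\<Sum>i<n. \<Sum>j<k. \<Sum>x<s. count (ends (P i ! j)) x)"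
      by (subst sum.swap, rule sum.cong[OF refl], rule sum.swap)
    also have "(\<Sum>x<s. \<Sum>q<\<delta>. of_bool (x \<in> ?U q)) = (\<Sum>q<\<delta>. card (?U q))"
      by (subst sum.swap) (simp add: sum_of_bool_lessThan)
    finally have 1: "k * s = (\<Sum>i<n. \<Sum>j<k. \<Sum>x<s. count (ends (P i ! j)) x) + (\<Sum>q<\<delta>. card (?U q))" .
    have "(\<Sum>i<n. \<Sum>j<k. (\<Sum>x<s. count (ends (P i ! j)) x) + 2 * of_bool (P i ! j = [])) = (\<Sum>i<n. \<Sum>j<k. 2)"
      using ends_sum by (intro sum.cong refl) simp
    then have 2: "(\<Sum>i<n. \<Sum>j<k. \<Sum>x<s. count (ends (P i ! j)) x) + (\<Sum>i<n. \<Sum>j<k. 2 * of_bool (P i ! j = [])) = n * (k * 2)"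
      by (simp add: sum.distrib)
    have "(\<Sum>q<\<delta>. card (?U q) + (k - card (?U q))) = (\<Sum>q<\<delta>. k)"
      using M(2) by (intro sum.cong refl) simp
    then have 3: "(\<Sum>q<\<delta>. card (?U q)) + (\<Sum>q<\<delta>. k - card (?U q)) = \<delta> * k"
      by (simp add: sum.distrib)
    have "k - 1 + s = 2 * n + \<delta>" using sk k by simp
    then have "k * (k - 1) + k * s = n * (k * 2) + \<delta> * k"
      by (metis (no_types, lifting) distrib_left mult.assoc mult.commute)
    then show ?thesis using 1 2 3 by linarith
  qed
  have pronic: "(k - 1) * 2 + (k - 2) * (k - 1) = k * (k - 1)"
    using k by (metis add_mult_distrib le_add_diff_inverse mult.commute)
  \<comment> \<open>An ear sends \<open>(k - 2) * (k - 1)\<close> to its dummies and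
    \<open>2 * (k - 1)\<close> elsewhere: \<open>k - 1\<close> for each end at an old vertex, or 2
    to each of \<open>k - 1\<close> nodes if it is a loop.\<close>
  have row: "(\<Sum>b\<in>B. w a b) = k * (k - 1)" if aA: "a \<in> A" for a
  proof (cases a)
    case (Inl ij)
    then obtain i j where a: "a = Inl (i, j)" "i < n" "j < k" using aA by (auto simp: A_def)
    have "(\<Sum>i'<n. \<Sum>t<k - 2. if i = i' then k - 1 else 0) = (\<Sum>i'<n. if i = i' then (k - 2) * (k - 1) else 0)"
      by (intro sum.cong) auto
    then have d: "(\<Sum>i'<n. \<Sum>t<k - 2. if i = i' then k - 1 else 0) = (k - 2) * (k - 1)"
      using a by simp
    show ?thesis
      using ends_sum[OF a(2,3)] pronic
      by (cases "P i ! j = []") (simp_all add: a(1,2) sumB d flip: sum_distrib_left)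
  next
    case (Inr q)
    then have q: "q < \<delta>" using aA by (auto simp: A_def)
    have "(\<Sum>b\<in>B. w a b) = (k - 1) * card (?U q) + (k - 1) * (k - card (?U q))"
      by (simp add: Inr sumB sum_of_bool_lessThan flip: sum_distrib_left)
    also have "\<dots> = (k - 1) * k" using M(2)[OF q] by (metis distrib_left le_add_diff_inverse)
    finally show ?thesis by simp
  qed
  have col: "(\<Sum>a\<in>A. w a b) = k * (k - 1)" if "b \<in> B" for b
  proof -
    consider x where "b = Inl x" "x < s" | t where "b = Inr (Inl t)"
      | i t where "b = Inr (Inr (i, t))" "i < n" using \<open>b \<in> B\<close> by (auto simp: B_def)
    then show ?thesis
    proof cases
      case 1
      have "(\<Sum>a\<in>A. w a b) = (k - 1) * ((\<Sum>i<n. \<Sum>j<k. count (ends (P i ! j)) x) + (\<Sum>q<\<delta>. of_bool (x \<in> ?U q)))"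
        by (simp add: 1 sumA distrib_left sum_distrib_left)
      then show ?thesis using ends_total[OF 1(2)] by simp
    next
      case 2
      have "(\<Sum>i<n. \<Sum>j<k. if P i ! j = [] then 2 else 0) = (\<Sum>i<n. \<Sum>j<k. 2 * of_bool (P i ! j = []) :: nat)"
        by (intro sum.cong) auto
      then show ?thesis using loops by (simp add: 2 sumA)
    next
      case 3
      have "(\<Sum>i'<n. \<Sum>j<k. if i' = i then k - 1 else 0) = (\<Sum>i'<n. if i' = i then k * (k - 1) else 0)"
        by (intro sum.cong) auto
      then show ?thesis using 3 by (simp add: sumA)
    qed
  qed
  obtain f where f: "bij_betw f A B" and w_pos: "\<And>a. a \<in> A \<Longrightarrow> 0 < w a (f a)"
    by (rule regular_bipartite_perfect_matching[of A B "k * (k - 1)" w])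
      (use row col k in \<open>auto simp: A_def B_def\<close>)
  define h where "h b = (case b of Inl x \<Rightarrow> {#{x, s}#} | Inr _ \<Rightarrow> {#})"
    for b :: "nat + nat + nat \<times> nat"
  define g where "g a = h (f a)" for a
  \<comment> \<open>The matching hits each old vertex \<open>x\<close> exactly once, hence the new
    edges form the star of \<open>s\<close>.\<close>
  have sum_g: "(\<Sum>a\<in>A. g a) = (\<Sum>x<s. {#{x, s}#})"
  proof -
    have "(\<Sum>a\<in>A. g a) = (\<Sum>b\<in>B. h b)" unfolding g_def using f by (rule sum.reindex_bij_betw)
    then show ?thesis by (simp add: sumB h_def)
  qed
  have colour: "\<exists>P'. length P' = k - 1 \<and> mset (concat P') = add_mset s (mset (concat (P i)))
     \<and> (\<Sum>p\<in>#mset P'. path_edges p) = (\<Sum>p\<in>#mset (P i). path_edges p) + (\<Sum>j<k. g (Inl (i, j)))"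
    if i: "i < n" for i
  proof -
    \<comment> \<open>The ears of colour \<open>i\<close> left unchanged. A dummy has positive
      weight only to ears of its own colour, so all \<open>k - 2\<close> dummies of colour
      \<open>i\<close> are matched to such ears.\<close>
    define D where "D = {j. j < k \<and> f (Inl (i, j)) \<in> Inr ` Inr ` ({i} \<times> {..<k - 2})}"
    have inA: "Inl (i, j) \<in> A" if "j < k" for j using i that by (auto simp: A_def)
    have "bij_betw (\<lambda>j. f (Inl (i, j))) D (Inr ` Inr ` ({i} \<times> {..<k - 2}))"
    proof (rule bij_betw_imageI)
      show "inj_on (\<lambda>j. f (Inl (i, j))) D"
        using f inA by (auto simp: bij_betw_def inj_on_def D_def)
      show "(\<lambda>j. f (Inl (i, j))) ` D = Inr ` Inr ` ({i} \<times> {..<k - 2})"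
      proof (intro equalityI subsetI)
        fix b assume b: "b \<in> (Inr ` Inr ` ({i} \<times> {..<k - 2}) :: (nat + nat + nat \<times> nat) set)"
        then have "b \<in> B" using i by (auto simp: B_def)
        then obtain a where a: "a \<in> A" "f a = b" using f by (auto simp: bij_betw_def)
        obtain t where t: "b = Inr (Inr (i, t))" using b by auto
        have "0 < w a (Inr (Inr (i, t)))" using w_pos[OF a(1)] a(2) t by simp
        then obtain j where "a = Inl (i, j)" "j < k" using a(1)
          by (auto simp: A_def split: if_splits)
        then show "b \<in> (\<lambda>j. f (Inl (i, j))) ` D" using a b by (auto simp: D_def)
      qed (auto simp: D_def)
    qed
    then have "card D = card (Inr ` Inr ` ({i} \<times> {..<k - 2}) :: (nat + nat + nat \<times> nat) set)"
      by (rule bij_betw_same_card)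
    also have "\<dots> = k - 2" by (simp add: card_image card_cartesian_product)
    finally have cardD: "card D = k - 2" .
    have subD: "D \<subseteq> {..<k}" by (auto simp: D_def)
    show ?thesis
    proof (rule detach_colour[where J = "{..<k} - D"])
      show "card ({..<k} - D) = 2"
        using cardD subD k by (subst card_Diff_subset) (auto intro: finite_subset)
      show "g (Inl (i, j)) = {#}" if "j < k" "j \<notin> {..<k} - D" for j
        using that by (auto simp: D_def g_def h_def)
      show "ear_end s (P i ! j) (g (Inl (i, j)))" if j: "j \<in> {..<k} - D" for j
      proof -
        have a: "Inl (i, j) \<in> A" using inA j by simp
        then have "f (Inl (i, j)) \<in> B" using f by (auto simp: bij_betw_def)
        then consider x where "f (Inl (i, j)) = Inl x" | t where "f (Inl (i, j)) = Inr (Inl t)"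
          | i' t where "f (Inl (i, j)) = Inr (Inr (i', t))" "t < k - 2" by (auto simp: B_def)
        then show ?thesis
        proof cases
          case 1
          then have "x \<in># ends (P i ! j)" using w_pos[OF a] by simp
          then show ?thesis using 1 by (auto simp: ear_end_def g_def h_def)
        next
          case 2
          then have "P i ! j = []" using w_pos[OF a] by (simp split: if_splits)
          then show ?thesis using 2 by (auto simp: ear_end_def g_def h_def)
        next
          case 3
          then have "i' = i" using w_pos[OF a] by (simp split: if_splits)
          then show ?thesis using 3 j by (auto simp: D_def)
        qed
      qed
    qed (use P(1) i in auto)
  qed
  then obtain P' where P': "\<And>i. i < n \<Longrightarrow> length (P' i) = k - 1"
    "\<And>i. i < n \<Longrightarrow> mset (concat (P' i)) = add_mset s (mset (concat (P i)))"
    "\<And>i. i < n \<Longrightarrow> (\<Sum>p\<in>#mset (P' i). path_edges p) = (\<Sum>p\<in>#mset (P i). path_edges p) + (\<Sum>j<k. g (Inl (i, j)))"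
    by metis
  define M' where "M' q = M q + g (Inr q)" for q
  have fac: "(\<forall>x. incidence x (M' q) \<le> 1) \<and> card (unmatched (Suc s) (M' q)) \<le> k - 1
      \<and> even (k - 1 + card (unmatched (Suc s) (M' q)))" if q: "q < \<delta>" for q
  proof -
    have a: "Inr q \<in> A" using q by (auto simp: A_def)
    have "M q \<subseteq># (\<Sum>q<\<delta>. M q)"
      using q by (metis finite_lessThan lessThan_iff mset_subset_eq_add_left sum.remove)
    then have "M q \<subseteq># mset_set (complete_edges s)"
      unfolding edges[symmetric] by (rule subset_mset.order_trans) simp
    then have "set_mset (M q) \<subseteq> complete_edges s" by (auto dest: mset_subset_eqD)
    then have new: "incidence s (M q) = 0" by (fastforce simp: incidence_eq_0_iff complete_edges_def)
    have "f (Inr q) \<in> B" using a f by (auto simp: bij_betw_def)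
    moreover have "0 < w (Inr q) (f (Inr q))" by (rule w_pos[OF a])
    ultimately consider x where "f (Inr q) = Inl x" "x \<in> ?U q"
      | t where "f (Inr q) = Inr (Inl t)" "card (?U q) < k"
      by (auto simp: B_def)
    then show ?thesis
    proof cases
      case 1
      then have g: "g (Inr q) = {#{x, s}#}" by (simp add: g_def h_def)
      have x: "x < s" "incidence x (M q) = 0" using 1 by (auto simp: unmatched_def)
      have "unmatched (Suc s) (M' q) = ?U q - {x}"
        using new x g by (auto simp: unmatched_def M'_def less_Suc_eq)
      then have c: "card (unmatched (Suc s) (M' q)) = card (?U q) - 1" "0 < card (?U q)"
        using 1 by (auto simp: card_gt_0_iff)
      have "incidence y (M' q) \<le> 1" for y
        using x new M(1)[OF q, of y] g by (auto simp: M'_def)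
      then show ?thesis using c M(2,3)[OF q] k by auto
    next
      case 2
      then have g: "g (Inr q) = {#}" by (simp add: g_def h_def)
      have "unmatched (Suc s) (M' q) = insert s (?U q)"
        using new g by (auto simp: unmatched_def M'_def less_Suc_eq)
      then have c: "card (unmatched (Suc s) (M' q)) = Suc (card (?U q))"
        by (simp add: unmatched_def)
      \<comment> \<open>Here a loop of the 1-factor gives one end to \<open>s\<close>, which becomes
        unmatched. By parity \<open>k\<close> exceeds \<open>card (?U q)\<close> by at least 2, so
        the other end of the loop is still there to be its partner.\<close>
      have "Suc (card (?U q)) < k" using 2(2) M(3)[OF q] by (cases "Suc (card (?U q)) = k") auto
      then show ?thesis using c M[OF q] g by (auto simp: M'_def)
    qed
  qed
  have "(\<Sum>i<n. (\<Sum>c\<in>#mset (C i). closed_edges c) + (\<Sum>p\<in>#mset (P' i). path_edges p)) + (\<Sum>q<\<delta>. M' q)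
      = ((\<Sum>i<n. (\<Sum>c\<in>#mset (C i). closed_edges c) + (\<Sum>p\<in>#mset (P i). path_edges p)) + (\<Sum>q<\<delta>. M q)) + (\<Sum>a\<in>A. g a)"
    by (simp add: P'(3) sumA M'_def sum.distrib)
  also have "\<dots> = mset_set (complete_edges (Suc s))"
    unfolding edges sum_g complete_edges_Suc ..
  finally have edges': "(\<Sum>i<n. (\<Sum>c\<in>#mset (C i). closed_edges c) + (\<Sum>p\<in>#mset (P' i). path_edges p)) + (\<Sum>q<\<delta>. M' q)
      = mset_set (complete_edges (Suc s))" .
  have "outline L n \<delta> (Suc s) (k - 1) C P' M'"
    unfolding outline_def using sk k P P' fac edges' by (simp add: lessThan_Suc)
  then show ?thesis by blast
qed

lemma outline_detach_all:
  assumes "outline L n \<delta> s k C P M" and "\<forall>l\<in>#L. 3 \<le> l" and "1 \<le> k"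
  shows "\<exists>P' M'. outline L n \<delta> (s + k - 1) 1 C P' M'"
  using assms
proof (induction k arbitrary: s P M)
  case (Suc k)
  show ?case
  proof (cases "k = 0")
    case False
    then obtain P' M' where "outline L n \<delta> (Suc s) k C P' M'"
      using outline_detach[OF Suc.prems(1,2)] by auto
    from Suc.IH[OF this Suc.prems(2)] False show ?thesis by simp
  qed (use Suc.prems in auto)
qed simp

section \<open>Closing the last ear\<close>

lemma set_mset_sum: "finite A \<Longrightarrow> set_mset (\<Sum>i\<in>A. E i) = (\<Union>i\<in>A. set_mset (E i))"
  by (induction A rule: finite_induct) auto

lemma set_mset_sum_mset: "set_mset (\<Sum>i\<in>#A. E i) = (\<Union>i\<in>set_mset A. set_mset (E i))"
  by (induction A) auto

lemma image_mset_sum: "image_mset f (\<Sum>i\<in>A. E i) = (\<Sum>i\<in>A. image_mset f (E i))"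
  by (induction A rule: infinite_finite_induct) auto

lemma distinct_concat_disjoint:
  "distinct (concat xs) \<Longrightarrow> i < length xs \<Longrightarrow> j < length xs \<Longrightarrow> i \<noteq> j
    \<Longrightarrow> set (xs ! i) \<inter> set (xs ! j) = {}"
proof (induction xs arbitrary: i j)
  case (Cons x xs)
  then show ?case by (cases i; cases j) (fastforce simp: in_set_conv_nth)+
qed simp

text \<open>In \<open>mset_set\<close> every edge has multiplicity at most one, so the multiset
  equation makes the edge sets of the factors pairwise disjoint and disjoint from the 1-factor. The
  family \<open>I\<close> is empty for odd order; for even order its only member is the matching
  removed from the complete graph.\<close>

lemma OP_solvable_if_factorization:
  fixes F :: "nat \<Rightarrow> nat list list" and I :: "nat \<Rightarrow> nat set multiset"
  assumes L: "\<forall>l\<in>#L. 3 \<le> l"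
    and F: "\<And>i. i < n \<Longrightarrow> mset (map length (F i)) = L"
    and V: "\<And>i. i < n \<Longrightarrow> mset (concat (F i)) = mset_set {..<sum_mset L}"
    and I: "\<And>q x. q < \<delta> \<Longrightarrow> x < sum_mset L \<Longrightarrow> incidence x (I q) = 1"
    and \<delta>: "\<delta> = of_bool (even (sum_mset L))"
    and edges: "(\<Sum>i<n. \<Sum>c\<in>#mset (F i). closed_edges c) + (\<Sum>q<\<delta>. I q)
        = mset_set (complete_edges (sum_mset L))"
  shows "OP_solvable L"
proof -
  define v where "v = sum_mset L"
  define E where "E i = (\<Sum>c\<in>#mset (F i). closed_edges c)" for i
  have count: "(\<Sum>i<n. count (E i) e) + (\<Sum>q<\<delta>. count (I q) e) \<le> 1" for e
  proof -
    have "(\<Sum>i<n. count (E i) e) + (\<Sum>q<\<delta>. count (I q) e)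
        = count ((\<Sum>i<n. E i) + (\<Sum>q<\<delta>. I q)) e" by (simp add: count_sum)
    also have "\<dots> = count (mset_set (complete_edges v)) e" using edges by (simp add: E_def v_def)
    also have "\<dots> \<le> 1" by (simp add: count_mset_set')
    finally show ?thesis .
  qed
  have union: "(\<Union>i<n. set_mset (E i)) \<union> (\<Union>q<\<delta>. set_mset (I q)) = complete_edges v"
    using arg_cong[OF edges, of set_mset] by (simp add: set_mset_sum E_def v_def)
  have disj: "set_mset (E i) \<inter> set_mset (E j) = {}" if "i < n" "j < n" "i \<noteq> j" for i j
  proof (rule ccontr)
    assume "set_mset (E i) \<inter> set_mset (E j) \<noteq> {}"
    then obtain e where "e \<in># E i" "e \<in># E j" by blast
    then have "2 \<le> count (E i) e + count (E j) e"
      by (metis add_mono count_greater_eq_one_iff one_add_one)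
    also have "\<dots> = (\<Sum>a\<in>{i, j}. count (E a) e)" using that by simp
    also have "\<dots> \<le> (\<Sum>a<n. count (E a) e)" using that by (intro sum_mono2) auto
    finally show False using count[of e] by simp
  qed
  have factor: "two_factor_of_type v L (set_mset (E i))" if i: "i < n" for i
    unfolding two_factor_of_type_def
  proof (intro exI[of _ "F i"] conjI)
    have d: "distinct (concat (F i))" using V[OF i] by (rule mset_eq_distinct)
    have "length c \<in># mset (map length (F i))" if "c \<in> set (F i)" for c using that by simp
    then have len: "3 \<le> length c" if "c \<in> set (F i)" for c using that L F[OF i] by metis
    show "\<forall>c\<in>set (F i). distinct c \<and> 3 \<le> length c"
      using d len by (auto intro: distinct_concat_member)
    show "\<forall>a<length (F i). \<forall>b<length (F i). a \<noteq> b \<longrightarrow> set (F i ! a) \<inter> set (F i ! b) = {}"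
      using distinct_concat_disjoint[OF d] by blast
    have "set (concat (F i)) = {..<v}"
      using arg_cong[OF V[OF i], of set_mset] by (simp add: v_def)
    then show "\<Union>(set ` set (F i)) = {0..<v}" by (simp add: lessThan_atLeast0)
    show "set_mset (E i) = (\<Union>c\<in>set (F i). cycle_edges c)"
    proof -
      have "set_mset (closed_edges c) = cycle_edges c" if "c \<in> set (F i)" for c
        using len[OF that] by (intro set_closed_edges) auto
      then show ?thesis by (simp add: E_def set_mset_sum_mset)
    qed
  qed (use F[OF i] in simp)
  have K: "K_star v (\<Union>i<n. set_mset (E i))"
  proof (cases "odd v")
    case True
    then show ?thesis using union \<delta> by (simp add: K_star_def v_def)
  next
    case False
    then have d: "\<delta> = 1" using \<delta> by (simp add: v_def)
    have "(\<Union>i<n. set_mset (E i)) \<inter> set_mset (I 0) = {}"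
    proof (rule ccontr)
      assume "(\<Union>i<n. set_mset (E i)) \<inter> set_mset (I 0) \<noteq> {}"
      then obtain e i where ei: "i < n" "e \<in># E i" "e \<in># I 0" by blast
      then have "1 \<le> (\<Sum>a\<in>{i}. count (E a) e)" by simp
      also have "\<dots> \<le> (\<Sum>a<n. count (E a) e)" using ei by (intro sum_mono2) auto
      finally have "1 \<le> (\<Sum>a<n. count (E a) e)" .
      moreover have "1 \<le> count (I 0) e" using ei by simp
      moreover have "(\<Sum>a<n. count (E a) e) + count (I 0) e \<le> 1" using count[of e] d by simp
      ultimately show False by linarith
    qed
    then have "(\<Union>i<n. set_mset (E i)) = complete_edges v - set_mset (I 0)"
      using union d by (auto simp: lessThan_Suc)
    moreover have "perfect_matching v (set_mset (I 0))"
      unfolding perfect_matching_def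
    proof (intro conjI allI impI)
      show "set_mset (I 0) \<subseteq> complete_edges v" using union d by (auto simp: lessThan_Suc)
      fix x assume "x < v"
      then have "size {#e \<in># I 0. x \<in> e#} = 1" using I[of 0 x] d by (simp add: incidence_def v_def)
      then obtain e where e: "{#e \<in># I 0. x \<in> e#} = {#e#}" using size_1_singleton_mset by blast
      have "e' \<in># I 0 \<and> x \<in> e' \<longleftrightarrow> e' = e" for e'
        using arg_cong[OF e, of "\<lambda>A. e' \<in># A"] by auto
      then show "\<exists>!e. e \<in># I 0 \<and> x \<in> e" by simp
    qed
    ultimately show ?thesis using False by (auto simp: K_star_def)
  qed
  show ?thesis
    unfolding OP_solvable_def Let_def v_def[symmetric]
  proof (intro exI conjI)
    show "K_star v (\<Union>i<n. set_mset (E i))" by (rule K)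
    let ?S = "(\<lambda>i. set_mset (E i)) ` {..<n}"
    show "\<forall>F\<in>?S. two_factor_of_type v L F" using factor by simp
    show "\<forall>A\<in>?S. \<forall>B\<in>?S. A \<noteq> B \<longrightarrow> A \<inter> B = {}"
    proof (intro ballI impI)
      fix A B assume "A \<in> ?S" "B \<in> ?S" "A \<noteq> B"
      then obtain i j where "i < n" "j < n" "A = set_mset (E i)" "B = set_mset (E j)" by auto
      with \<open>A \<noteq> B\<close> show "A \<inter> B = {}" using disj[of i j] by (cases "i = j") auto
    qed
  qed simp
qed

text \<open>With one vertex left, the size bound and the parity condition leave exactly one vertex
  \<open>u q\<close> unmatched in each 1-factor. Counting vertices shows that the single ear of each
  colour has \<open>y - 1\<close> of them, so joining both of its ends to \<open>s\<close> yields
  the cycle of length \<open>y\<close>.\<close>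

lemma outline_close:
  assumes out: "outline L n \<delta> s 1 C P M" and L: "\<forall>l\<in>#L. 3 \<le> l" and y: "3 \<le> y"
    and order: "Suc s = sum_mset L + y" and \<delta>: "\<delta> = of_bool (even (Suc s))"
  shows "OP_solvable (add_mset y L)"
proof -
  let ?U = "\<lambda>q. unmatched s (M q)"
  have v: "sum_mset (add_mset y L) = Suc s" using order by simp
  define p where "p i = hd (P i)" for i
  have P: "P i = [p i]" "mset (map length (C i)) = L"
    "mset (concat (C i)) + mset (p i) = mset_set {..<s}" if "i < n" for i
  proof -
    have "length (P i) = 1" using out that by (simp add: outline_def)
    then show "P i = [p i]" by (cases "P i") (auto simp: p_def)
    then show "mset (map length (C i)) = L" "mset (concat (C i)) + mset (p i) = mset_set {..<s}"
      using out that by (auto simp: outline_def)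
  qed
  have len: "length (p i) = y - 1" if "i < n" for i
  proof -
    have "length (concat (C i)) = sum_mset L"
      unfolding P(2)[OF that, symmetric] by (simp add: length_concat flip: sum_mset_sum_list)
    moreover have "length (concat (C i)) + length (p i) = s"
      using arg_cong[OF P(3)[OF that], of size] by simp
    ultimately show ?thesis using order by simp
  qed
  have nonempty: "p i \<noteq> []" if "i < n" for i using len[OF that] y by auto
  have M: "\<And>x. incidence x (M q) \<le> 1" "card (?U q) = 1" if "q < \<delta>" for q
  proof -
    show "incidence x (M q) \<le> 1" for x using out that by (auto simp: outline_def)
    have "card (?U q) \<le> 1" "even (1 + card (?U q))" using out that by (auto simp: outline_def)
    then show "card (?U q) = 1" by (cases "card (?U q)") auto
  qed
  define u where "u q = (THE x. x \<in> ?U q)" for q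
  have u: "?U q = {u q}" if "q < \<delta>" for q
    using M(2)[OF that] by (auto simp: card_1_singleton_iff u_def)
  have edges: "(\<Sum>i<n. (\<Sum>c\<in>#mset (C i). closed_edges c) + path_edges (p i)) + (\<Sum>q<\<delta>. M q)
      = mset_set (complete_edges s)"
    using out P(1) by (simp add: outline_def)
  \<comment> \<open>This is \<open>outline_ends\<close> for \<open>k = 1\<close>: every old vertex
    occurs exactly once, so joining all these places to \<open>s\<close> gives its star.\<close>
  have "(\<Sum>i<n. ends (p i)) + (\<Sum>q<\<delta>. {#u q#}) = (\<Sum>x<s. {#x#})"
  proof (rule multiset_eqI)
    fix x
    show "count ((\<Sum>i<n. ends (p i)) + (\<Sum>q<\<delta>. {#u q#})) x = count (\<Sum>x<s. {#x#}) x"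
    proof (cases "x < s")
      case True
      have "(\<Sum>q<\<delta>. count {#u q#} x) = (\<Sum>q<\<delta>. of_bool (x \<in> ?U q))"
        using u by (intro sum.cong) auto
      moreover have "(\<Sum>i<n. \<Sum>p\<in>#mset (P i). count (ends p) x) = (\<Sum>i<n. count (ends (p i)) x)"
        using P(1) by (intro sum.cong) auto
      ultimately show ?thesis
        using outline_ends[OF out L True] True by (simp add: count_sum)
    next
      case False
      have "x \<notin># ends (p i)" if "i < n" for i
      proof -
        have "set (p i) \<subseteq> {..<s}" using arg_cong[OF P(3)[OF that], of set_mset] by auto
        then show ?thesis
          using False hd_in_set[OF nonempty[OF that]] last_in_set[OF nonempty[OF that]]
          by (auto simp: ends_def)
      qed
      moreover have "u q \<noteq> x" if "q < \<delta>" for q using u[OF that] False by (auto simp: unmatched_def)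
      ultimately have "(\<Sum>i<n. count (ends (p i)) x) = 0" "(\<Sum>q<\<delta>. count {#u q#} x) = 0"
        by (auto simp: not_in_iff)
      then show ?thesis using False by (simp add: count_sum)
    qed
  qed
  from arg_cong[OF this, of "image_mset (\<lambda>x. {x, s})"]
  have new: "(\<Sum>i<n. image_mset (\<lambda>x. {x, s}) (ends (p i))) + (\<Sum>q<\<delta>. {#{u q, s}#}) = (\<Sum>x<s. {#{x, s}#})"
    by (simp add: image_mset_sum del: sum_multiset_singleton)
  have closed: "closed_edges (p i @ [s]) = path_edges (p i) + image_mset (\<lambda>x. {x, s}) (ends (p i))"
    if "i < n" for i
    using nonempty[OF that] by (simp add: closed_edges_def path_edges_snoc ends_def insert_commute)
  show ?thesis
  proof (rule OP_solvable_if_factorization[where F = "\<lambda>i. C i @ [p i @ [s]]"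
        and I = "\<lambda>q. add_mset {u q, s} (M q)" and n = n and \<delta> = \<delta>], unfold v)
    show "\<forall>l\<in>#add_mset y L. 3 \<le> l" using L y by simp
    show "mset (map length (C i @ [p i @ [s]])) = add_mset y L" if "i < n" for i
      using P(2)[OF that] len[OF that] y by simp
    show "mset (concat (C i @ [p i @ [s]])) = mset_set {..<Suc s}" if "i < n" for i
      using P(3)[OF that] by (simp add: lessThan_Suc)
    show "incidence x (add_mset {u q, s} (M q)) = 1" if "q < \<delta>" "x < Suc s" for q x
    proof -
      have "M q \<subseteq># (\<Sum>q<\<delta>. M q)"
        using that by (metis finite_lessThan lessThan_iff mset_subset_eq_add_left sum.remove)
      then have "M q \<subseteq># mset_set (complete_edges s)"
        unfolding edges[symmetric] by (rule subset_mset.order_trans) simp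
      then have "set_mset (M q) \<subseteq> complete_edges s" by (auto dest: mset_subset_eqD)
      then have s: "incidence s (M q) = 0" by (fastforce simp: incidence_eq_0_iff complete_edges_def)
      have "x = u q \<longleftrightarrow> incidence x (M q) = 0" if "x < s"
        using u[OF \<open>q < \<delta>\<close>] that by (auto simp: unmatched_def set_eq_iff)
      moreover have "u q < s" using u[OF \<open>q < \<delta>\<close>] by (auto simp: unmatched_def)
      ultimately show ?thesis using s M(1)[OF \<open>q < \<delta>\<close>, of x] \<open>x < Suc s\<close>
        by (cases "x = s") auto
    qed
    have "(\<Sum>i<n. \<Sum>c\<in>#mset (C i @ [p i @ [s]]). closed_edges c) + (\<Sum>q<\<delta>. add_mset {u q, s} (M q))
       = ((\<Sum>i<n. (\<Sum>c\<in>#mset (C i). closed_edges c) + path_edges (p i)) + (\<Sum>q<\<delta>. M q))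
         + ((\<Sum>i<n. image_mset (\<lambda>x. {x, s}) (ends (p i))) + (\<Sum>q<\<delta>. {#{u q, s}#}))"
    proof -
      have "(\<Sum>i<n. \<Sum>c\<in>#mset (C i @ [p i @ [s]]). closed_edges c)
        = (\<Sum>i<n. (\<Sum>c\<in>#mset (C i). closed_edges c) + path_edges (p i)) + (\<Sum>i<n. image_mset (\<lambda>x. {x, s}) (ends (p i)))"
        unfolding sum.distrib[symmetric] using closed by (intro sum.cong) auto
      moreover have "(\<Sum>q<\<delta>. add_mset {u q, s} (M q)) = (\<Sum>q<\<delta>. M q) + (\<Sum>q<\<delta>. {#{u q, s}#})"
        unfolding sum.distrib[symmetric] by (intro sum.cong) auto
      ultimately show ?thesis by simp
    qed
    then show "(\<Sum>i<n. \<Sum>c\<in>#mset (C i @ [p i @ [s]]). closed_edges c) + (\<Sum>q<\<delta>. add_mset {u q, s} (M q))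
        = mset_set (complete_edges (Suc s))"
      unfolding edges new complete_edges_Suc .
  qed (rule \<delta>)
qed

section \<open>Differences in cyclic groups\<close>

text \<open>Differences are taken in the integers. Those of the base cycles and of the zigzag path
  will be below \<open>n / 2\<close>, so distinct ones stay distinct up to sign modulo
  \<open>n\<close>.\<close>

fun path_diffs :: "int list \<Rightarrow> nat list" where
  "path_diffs (x # y # r) = nat \<bar>x - y\<bar> # path_diffs (y # r)"
| "path_diffs _ = []"

definition cycle_diffs :: "int list \<Rightarrow> nat list" where
  "cycle_diffs c = nat \<bar>last c - hd c\<bar> # path_diffs c"

lemma diffs_reflect: "path_diffs (map (\<lambda>x. c - x) p) = path_diffs p"
  by (induction p rule: path_diffs.induct) (auto simp: abs_minus_commute)

lemma length_diffs: "length (path_diffs p) = length p - 1"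
  by (induction p rule: path_diffs.induct) auto

text \<open>The largest difference \<open>d\<close> comes first, as the step from \<open>h\<close>
  to \<open>h - d\<close>. The path for the smaller ones, reflected by \<open>x\<close> to
  \<open>2 * h - d - x\<close>, continues from \<open>h - d\<close> inside
  \<open>{h - d..h - 1}\<close> and so avoids \<open>h\<close>.\<close>

lemma zigzag_path:
  fixes S :: "nat set"
  assumes "finite S" "0 \<notin> S" "\<forall>d\<in>S. d \<le> m"
  shows "\<exists>p. p \<noteq> [] \<and> hd p = h \<and> distinct p \<and> set p \<subseteq> {h - int m..h} \<and> mset (path_diffs p) = mset_set S"
  using assms
proof (induction S arbitrary: m rule: finite_linorder_max_induct)
  case empty
  then show ?case by (intro exI[of _ "[h]"]) auto
next
  case (insert d S)
  have "\<forall>a\<in>S. a \<le> d - 1" using insert.hyps insert.prems by fastforce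
  then obtain p where p: "p \<noteq> []" "hd p = h" "distinct p" "set p \<subseteq> {h - int (d - 1)..h}"
    "mset (path_diffs p) = mset_set S" using insert.IH[of "d - 1"] insert.prems by auto
  have d: "0 < d" "d \<le> m" using insert.prems by auto
  let ?q = "map (\<lambda>x. 2 * h - int d - x) p"
  have q: "set ?q \<subseteq> {h - int d..h - 1}" using p(4) d by auto
  have "path_diffs (h # ?q) = d # path_diffs ?q" using p(1,2) by (cases p) auto
  then have "mset (path_diffs (h # ?q)) = mset_set (insert d S)"
    using p(5) insert.hyps by (auto simp: diffs_reflect)
  moreover have "distinct (h # ?q)" using q p(3) by (auto simp: distinct_map inj_on_def)
  moreover have "set (h # ?q) \<subseteq> {h - int m..h}" using q d by (auto simp: subset_iff)
  ultimately show ?case by (intro exI[of _ "h # ?q"]) auto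
qed

text \<open>Here \<open>h\<close> and \<open>t\<close> are the intended neighbours of
  \<open>x\<close>. Each forbids two places per used difference, and the midpoint of
  \<open>h\<close> and \<open>t\<close> is excluded because there the two new differences would
  coincide.\<close>

lemma exists_avoiding:
  fixes W X :: "int set" and D :: "nat set"
  assumes "finite X" "finite D" "finite W" "card X + 4 * card D + 1 < card W"
  shows "\<exists>x\<in>W. x \<notin> X \<and> nat \<bar>x - h\<bar> \<notin> D \<and> nat \<bar>x - t\<bar> \<notin> D \<and> 2 * x \<noteq> h + t"
proof -
  let ?B = "X \<union> ((\<lambda>d. h + int d) ` D \<union> (\<lambda>d. h - int d) ` D)
     \<union> ((\<lambda>d. t + int d) ` D \<union> (\<lambda>d. t - int d) ` D) \<union> {(h + t) div 2}"
  have "card ?B \<le> card X + (card D + card D) + (card D + card D) + 1"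
    using assms by (intro order.trans[OF card_Un_le] add_mono card_image_le) auto
  then have "\<not> W \<subseteq> ?B" using assms card_mono[of ?B W] by auto
  then obtain x where x: "x \<in> W" "x \<notin> ?B" by blast
  have far: "nat \<bar>x - c\<bar> \<notin> D" if "x \<notin> (\<lambda>d. c + int d) ` D" "x \<notin> (\<lambda>d. c - int d) ` D" for c
  proof
    assume "nat \<bar>x - c\<bar> \<in> D"
    moreover have "x = c + int (nat \<bar>x - c\<bar>) \<or> x = c - int (nat \<bar>x - c\<bar>)" by linarith
    ultimately show False using that by blast
  qed
  have "2 * x \<noteq> h + t" using x(2) by auto
  then show ?thesis using x far[of h] far[of t] by blast
qed

lemma exists_path_distinct_diffs:
  fixes W X :: "int set" and D :: "nat set"
  assumes "finite X" "finite D" "finite W" "card X + r + 4 * (card D + r) + 1 < card W"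
  shows "\<exists>p. length p = Suc r \<and> distinct p \<and> set p \<subseteq> W - X \<and> distinct (path_diffs p) \<and> set (path_diffs p) \<inter> D = {}"
  using assms(4)
proof (induction r)
  case 0
  then obtain x where "x \<in> W" "x \<notin> X" using exists_avoiding[OF assms(1-3), of 0 0] by auto
  then show ?case by (intro exI[of _ "[x]"]) auto
next
  case (Suc r)
  then obtain p where p: "length p = Suc r" "distinct p" "set p \<subseteq> W - X" "distinct (path_diffs p)"
    "set (path_diffs p) \<inter> D = {}" by auto
  have "card (X \<union> set p) \<le> card X + Suc r"
    using p by (metis card_Un_le distinct_card)
  moreover have "card (D \<union> set (path_diffs p)) \<le> card D + r"
    using p by (metis card_Un_le distinct_card length_diffs diff_Suc_1)
  ultimately have "card (X \<union> set p) + 4 * card (D \<union> set (path_diffs p)) + 1 < card W"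
    using Suc.prems by (simp add: algebra_simps)
  then obtain x where x: "x \<in> W" "x \<notin> X \<union> set p" "nat \<bar>x - hd p\<bar> \<notin> D \<union> set (path_diffs p)"
    using exists_avoiding[of "X \<union> set p" "D \<union> set (path_diffs p)" W "hd p" "hd p"] assms by auto
  have "path_diffs (x # p) = nat \<bar>x - hd p\<bar> # path_diffs p" using p(1) by (cases p) auto
  then show ?case using p x by (intro exI[of _ "x # p"]) auto
qed

lemma exists_cycle_distinct_diffs:
  fixes W X :: "int set" and D :: "nat set"
  assumes "finite X" "finite D" "finite W" "3 \<le> l" "card X + l + 4 * (card D + l) + 1 < card W"
  shows "\<exists>c. length c = l \<and> distinct c \<and> set c \<subseteq> W - X \<and> distinct (cycle_diffs c) \<and> set (cycle_diffs c) \<inter> D = {}"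
proof -
  \<comment> \<open>A path with \<open>l - 1\<close> vertices, hence \<open>l - 2\<close>
    differences, is found first; one more vertex then closes it.\<close>
  define r where "r = l - 2"
  have l: "l = r + 2" "1 \<le> r" using assms(4) by (auto simp: r_def)
  obtain p where p: "length p = Suc r" "distinct p" "set p \<subseteq> W - X" "distinct (path_diffs p)"
    "set (path_diffs p) \<inter> D = {}" using exists_path_distinct_diffs[OF assms(1-3), of r] assms(5) l by auto
  have "card (X \<union> set p) \<le> card X + Suc r"
    using p by (metis card_Un_le distinct_card)
  moreover have "card (D \<union> set (path_diffs p)) \<le> card D + r"
    using p by (metis card_Un_le distinct_card length_diffs diff_Suc_1)
  ultimately have "card (X \<union> set p) + 4 * card (D \<union> set (path_diffs p)) + 1 < card W"
    using assms(5) l unfolding distrib_left by linarith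
  then obtain x where x: "x \<in> W" "x \<notin> X \<union> set p" "nat \<bar>x - hd p\<bar> \<notin> D \<union> set (path_diffs p)"
      "nat \<bar>x - last p\<bar> \<notin> D \<union> set (path_diffs p)" "2 * x \<noteq> hd p + last p"
    using exists_avoiding[of "X \<union> set p" "D \<union> set (path_diffs p)" W "hd p" "last p"] assms by auto
  have ne: "hd p \<noteq> last p" using p(1,2) l by (cases p) (auto split: if_splits)
  then have "nat \<bar>x - hd p\<bar> \<noteq> nat \<bar>x - last p\<bar>" using x(5) by linarith
  moreover have "cycle_diffs (x # p) = nat \<bar>x - last p\<bar> # nat \<bar>x - hd p\<bar> # path_diffs p"
    using p(1) by (cases p) (auto simp: cycle_diffs_def abs_minus_commute)
  ultimately show ?thesis using p x l by (intro exI[of _ "x # p"]) auto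
qed

text \<open>A cycle of length \<open>l\<close> uses \<open>l\<close> places and \<open>l\<close>
  differences. A place costs 1 and a difference costs 4 forbidden positions, and the midpoint costs
  one more, which explains \<open>5 * sum_list ls + 1\<close>.\<close>

lemma exists_cycles_distinct_diffs:
  fixes W :: "int set"
  assumes "finite W" "\<forall>l\<in>set ls. 3 \<le> l" "5 * sum_list ls + 1 < card W"
  shows "\<exists>cs. map length cs = ls \<and> distinct (concat cs) \<and> set (concat cs) \<subseteq> W
    \<and> distinct (concat (map cycle_diffs cs))"
  using assms(2,3)
proof (induction ls)
  case (Cons l ls)
  then obtain cs where cs: "map length cs = ls" "distinct (concat cs)" "set (concat cs) \<subseteq> W"
    "distinct (concat (map cycle_diffs cs))" by auto
  let ?X = "set (concat cs)" and ?D = "set (concat (map cycle_diffs cs))"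
  have X: "card ?X = sum_list ls" using cs by (simp only: distinct_card length_concat)
  have pos: "\<forall>c\<in>set cs. 3 \<le> length c" using cs(1) Cons.prems(1) by (auto simp flip: cs(1))
  then have "map length (map cycle_diffs cs) = map length cs"
    by (auto simp: cycle_diffs_def length_diffs)
  then have "card ?D = sum_list ls" using cs by (simp only: distinct_card length_concat)
  then have "card ?X + l + 4 * (card ?D + l) + 1 < card W" using X Cons.prems(2) by simp
  then obtain c where c: "length c = l" "distinct c" "set c \<subseteq> W - ?X" "distinct (cycle_diffs c)"
    "set (cycle_diffs c) \<inter> ?D = {}"
    using exists_cycle_distinct_diffs[of ?X ?D W l] assms(1) Cons.prems(1) by auto
  then show ?case using cs by (intro exI[of _ "c # cs"]) auto
qed simp

section \<open>Translates and orbits of edges modulo n\<close>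

definition translate :: "nat \<Rightarrow> nat \<Rightarrow> int \<Rightarrow> nat" where
  "translate n i x = nat ((x + int i) mod int n)"

definition orbit :: "nat \<Rightarrow> nat \<Rightarrow> nat set multiset" where
  "orbit n d = (\<Sum>j<n. {#{j, (j + d) mod n}#})"

lemma bij_translate:
  assumes "0 < n"
  shows "bij_betw (\<lambda>i. translate n i a) {..<n} {..<n}"
proof -
  have inj: "inj_on (\<lambda>i. translate n i a) {..<n}"
  proof (rule inj_onI)
    fix i j assume ij: "i \<in> {..<n}" "j \<in> {..<n}" "translate n i a = translate n j a"
    then have "(a + int i) mod int n = (a + int j) mod int n"
      using assms by (simp add: translate_def eq_nat_nat_iff)
    then have "int n dvd (int i - int j)" by (simp add: mod_eq_dvd_iff)
    then show "i = j" using ij dvd_imp_le_int[of "int i - int j" "int n"] by fastforce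
  qed
  moreover have "(\<lambda>i. translate n i a) ` {..<n} \<subseteq> {..<n}"
    using assms by (auto simp: translate_def nat_less_iff)
  ultimately show ?thesis by (simp add: bij_betw_def endo_inj_surj)
qed

lemma inj_translate: "inj_on (translate n i) {0..<int n}"
proof (rule inj_onI)
  fix x y assume xy: "x \<in> {0..<int n}" "y \<in> {0..<int n}" "translate n i x = translate n i y"
  then have "(x + int i) mod int n = (y + int i) mod int n"
    by (simp add: translate_def eq_nat_nat_iff)
  then have "int n dvd (x - y)" by (simp add: mod_eq_dvd_iff)
  then show "x = y" using xy dvd_imp_le_int[of "x - y" "int n"] by fastforce
qed

lemma translate_less: "0 < n \<Longrightarrow> translate n i x < n"
  by (auto simp: translate_def nat_less_iff)

lemma int_translate: "0 < n \<Longrightarrow> int (translate n i x) = (x + int i) mod int n"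
  by (simp add: translate_def)

lemma translate_add:
  assumes "0 < n"
  shows "translate n i (a + int d) = (translate n i a + d) mod n"
proof -
  have "int (translate n i (a + int d)) = int ((translate n i a + d) mod n)"
    using assms by (simp add: int_translate zmod_int mod_add_right_eq add_ac)
  then show ?thesis by simp
qed

text \<open>As \<open>i\<close> runs over the residues, so does the translate of the smaller end;
  hence only the difference of the edge matters.\<close>

lemma sum_translate_edge:
  assumes "0 < n"
  shows "(\<Sum>i<n. {#{translate n i a, translate n i b}#}) = orbit n (nat \<bar>a - b\<bar>)"
proof -
  have main: "(\<Sum>i<n. {#{translate n i a, translate n i (a + int d)}#}) = orbit n d" for a d
    unfolding translate_add[OF assms] orbit_def
    using sum.reindex_bij_betw[OF bij_translate[OF assms, of a], of "\<lambda>j. {#{j, (j + d) mod n}#}"] .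
  show ?thesis
  proof (cases "a \<le> b")
    case True
    then show ?thesis using main[of a "nat (b - a)"] by simp
  next
    case False
    then show ?thesis using main[of b "nat (a - b)"] by (simp add: insert_commute)
  qed
qed

lemma sum_translate_path:
  "0 < n \<Longrightarrow> (\<Sum>i<n. path_edges (map (translate n i) p)) = (\<Sum>d\<in>#mset (path_diffs p). orbit n d)"
proof (induction p rule: path_diffs.induct)
  case (1 x y r)
  have "(\<Sum>i<n. path_edges (map (translate n i) (x # y # r)))
     = (\<Sum>i<n. {#{translate n i x, translate n i y}#} + path_edges (map (translate n i) (y # r)))"
    by simp
  also have "\<dots> = orbit n (nat \<bar>x - y\<bar>) + (\<Sum>d\<in>#mset (path_diffs (y # r)). orbit n d)"
    unfolding sum.distrib sum_translate_edge[OF 1(2)] 1(1)[OF 1(2)] ..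
  finally show ?case by simp
qed auto

lemma sum_translate_cycle:
  assumes "0 < n" "c \<noteq> []"
  shows "(\<Sum>i<n. closed_edges (map (translate n i) c)) = (\<Sum>d\<in>#mset (cycle_diffs c). orbit n d)"
proof -
  have "(\<Sum>i<n. closed_edges (map (translate n i) c))
     = (\<Sum>i<n. {#{translate n i (last c), translate n i (hd c)}#} + path_edges (map (translate n i) c))"
    using assms(2) by (simp add: closed_edges_def last_map hd_map)
  also have "\<dots> = orbit n (nat \<bar>last c - hd c\<bar>) + (\<Sum>d\<in>#mset (path_diffs c). orbit n d)"
    unfolding sum.distrib sum_translate_edge[OF assms(1)] sum_translate_path[OF assms(1)] ..
  finally show ?thesis by (simp add: cycle_diffs_def)
qed

lemma sum_translate_cycles:
  assumes "0 < n" "\<forall>c\<in>set cs. c \<noteq> []"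
  shows "(\<Sum>i<n. \<Sum>c\<in>#mset (map (map (translate n i)) cs). closed_edges c)
     = (\<Sum>d\<in>#mset (concat (map cycle_diffs cs)). orbit n d)"
  using assms(2)
proof (induction cs)
  case (Cons c cs)
  then show ?case using assms(1) by (simp add: sum.distrib sum_translate_cycle)
qed simp

text \<open>For even \<open>n\<close> the orbit of the difference \<open>n / 2\<close> has only half the length.\<close>
lemma complete_edges_orbits:
  assumes "0 < n"
  shows "mset_set (complete_edges n) = (\<Sum>d\<in>{d. 0 < d \<and> 2 * d < n}. orbit n d)
     + (if even n then (\<Sum>j<n div 2. {#{j, j + n div 2}#}) else {#})"
proof -
  \<comment> \<open>An edge is encoded by a difference and a starting point. \<open>T\<close> holds
    the differences below \<open>n / 2\<close> with all starting points, \<open>H\<close> the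
    difference \<open>n / 2\<close> with half of them.\<close>
  define \<phi> where "\<phi> = (\<lambda>(d, j). {j, (j + d) mod n})"
  define T where "T = {d. 0 < d \<and> 2 * d < n} \<times> {..<n}"
  define H where "H = (if even n then {n div 2} \<times> {..<n div 2} else {})"
  have finD: "finite {d. 0 < d \<and> 2 * d < n}" by (rule finite_subset[of _ "{..<n}"]) auto
  then have fin: "finite T" "finite H" by (auto simp: T_def H_def)
  have disj: "T \<inter> H = {}" by (auto simp: T_def H_def)
  have TH: "0 < d" "2 * d \<le> n" "j < n" "2 * d = n \<Longrightarrow> j < d" if "(d, j) \<in> T \<union> H" for d j
    using that assms by (auto simp: T_def H_def split: if_splits elim: evenE)
  have md: "(j + d) mod n = (if j + d < n then j + d else j + d - n)" if "j < n" "2 * d \<le> n" for j d :: nat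
    using that by (auto simp: mod_if)
  have "inj_on \<phi> (T \<union> H)"
  proof (rule inj_onI)
    fix a b assume a: "a \<in> T \<union> H" and b: "b \<in> T \<union> H" and eq: "\<phi> a = \<phi> b"
    obtain d j d' j' where ab: "a = (d, j)" "b = (d', j')" by fastforce
    note 1 = TH[OF a[unfolded ab]] and 2 = TH[OF b[unfolded ab]]
    have "j = j' \<and> (j + d) mod n = (j' + d') mod n \<or> j = (j' + d') mod n \<and> (j + d) mod n = j'"
      using eq by (simp add: \<phi>_def ab doubleton_eq_iff)
    then have "d = d' \<and> j = j'"
    proof
      assume "j = j' \<and> (j + d) mod n = (j' + d') mod n"
      then show ?thesis unfolding md[OF 1(3,2)] md[OF 2(3,2)] using 1(1,2) 2(1,2)
        by (auto split: if_splits)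
    next
      \<comment> \<open>Opposite orientations force \<open>d + d' = n\<close>, so both equal
        \<open>n / 2\<close>; the restricted starting points in \<open>H\<close> then rule this
        out.\<close>
      assume opp: "j = (j' + d') mod n \<and> (j + d) mod n = j'"
      then have "2 * d = n \<and> 2 * d' = n"
        unfolding md[OF 1(3,2)] md[OF 2(3,2)] using 1(1,2) 2(1,2) by (auto split: if_splits)
      moreover from this have "j < d" "j' < d'" using 1(4) 2(4) by auto
      ultimately show ?thesis
        using opp unfolding md[OF 1(3,2)] md[OF 2(3,2)] by (auto split: if_splits)
    qed
    then show "a = b" by (simp add: ab)
  qed
  moreover have "\<phi> ` (T \<union> H) = complete_edges n"
  proof (intro equalityI subsetI)
    fix e assume "e \<in> \<phi> ` (T \<union> H)"
    then obtain d j where dj: "(d, j) \<in> T \<union> H" "e = {j, (j + d) mod n}" by (auto simp: \<phi>_def)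
    note 1 = TH[OF dj(1)]
    have "(j + d) mod n \<noteq> j" unfolding md[OF 1(3,2)] using 1 by auto
    then show "e \<in> complete_edges n"
      using dj(2) 1(3) assms unfolding complete_edges_def by (metis (mono_tags, lifting) mem_Collect_eq mod_less_divisor)
  next
    have *: "{x, y} \<in> \<phi> ` (T \<union> H)" if "x < y" "y < n" for x y
    proof -
      consider "2 * (y - x) < n" | "2 * (y - x) = n" | "2 * (y - x) > n" by linarith
      then show ?thesis
      proof cases
        case 1
        then have "(y - x, x) \<in> T \<union> H" "\<phi> (y - x, x) = {x, y}" using that by (auto simp: T_def \<phi>_def)
        then show ?thesis by (metis imageI)
      next
        case 2
        then have "(y - x, x) \<in> T \<union> H" "\<phi> (y - x, x) = {x, y}" using that by (auto simp: H_def \<phi>_def)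
        then show ?thesis by (metis imageI)
      next
        case 3
        then have "(n - (y - x), y) \<in> T \<union> H" using that by (auto simp: T_def)
        moreover have "(y + (n - (y - x))) mod n = x" using that by (simp add: mod_if)
        then have "\<phi> (n - (y - x), y) = {x, y}" by (auto simp: \<phi>_def)
        ultimately show ?thesis by (metis imageI)
      qed
    qed
    fix e assume "e \<in> complete_edges n"
    then obtain x y where "x < n" "y < n" "x \<noteq> y" "e = {x, y}" by (auto simp: complete_edges_def)
    then show "e \<in> \<phi> ` (T \<union> H)" using *[of x y] *[of y x] by (metis insert_commute nat_neq_iff)
  qed
  ultimately have "mset_set (complete_edges n) = image_mset \<phi> (mset_set (T \<union> H))"
    by (simp add: image_mset_mset_set)
  also have "\<dots> = (\<Sum>a\<in>T \<union> H. {#\<phi> a#})" by (simp add: sum_unfold_sum_mset)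
  also have "\<dots> = (\<Sum>a\<in>T. {#\<phi> a#}) + (\<Sum>a\<in>H. {#\<phi> a#})" using fin disj by (rule sum.union_disjoint)
  also have "(\<Sum>a\<in>T. {#\<phi> a#}) = (\<Sum>d\<in>{d. 0 < d \<and> 2 * d < n}. orbit n d)"
    unfolding T_def orbit_def \<phi>_def by (simp add: sum.cartesian_product case_prod_beta)
  also have "(\<Sum>a\<in>H. {#\<phi> a#}) = (if even n then (\<Sum>j<n div 2. {#{j, j + n div 2}#}) else {#})"
  proof (cases "even n")
    case True
    have "(\<Sum>a\<in>H. {#\<phi> a#}) = (\<Sum>d\<in>{n div 2}. \<Sum>j<n div 2. {#{j, (j + d) mod n}#})"
      unfolding sum.cartesian_product \<phi>_def H_def using True by (simp add: case_prod_beta)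
    also have "\<dots> = (\<Sum>j<n div 2. {#{j, j + n div 2}#})" by simp
    finally show ?thesis using True by simp
  qed (simp add: H_def)
  finally show ?thesis .
qed

section \<open>The outline over the cyclic group\<close>

lemma path_diffs_elem:
  "d \<in> set (path_diffs p) \<Longrightarrow> distinct p \<Longrightarrow> \<exists>x\<in>set p. \<exists>y\<in>set p. x \<noteq> y \<and> d = nat \<bar>x - y\<bar>"
  by (induction p rule: path_diffs.induct) fastforce+

lemma cycle_diffs_elem:
  assumes "d \<in> set (cycle_diffs c)" "distinct c" "2 \<le> length c"
  shows "\<exists>x\<in>set c. \<exists>y\<in>set c. x \<noteq> y \<and> d = nat \<bar>x - y\<bar>"
proof -
  have "last c \<noteq> hd c" "c \<noteq> []" using assms(2,3) by (cases c; auto split: if_splits)+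
  moreover from assms(1) consider "d = nat \<bar>last c - hd c\<bar>" | "d \<in> set (path_diffs c)"
    by (auto simp: cycle_diffs_def)
  ultimately show ?thesis
    using path_diffs_elem[of d c] assms(2) last_in_set[of c] hd_in_set[of c] by cases blast+
qed

text \<open>Uncovered vertices become one-vertex ears and the other missing ears become loops.
  Neither kind records an edge.\<close>

lemma pad_ears:
  fixes n :: nat
  assumes "distinct (xs @ concat es)" "set (xs @ concat es) \<subseteq> {..<n}" "length es + n \<le> k"
  shows "\<exists>P. length P = k \<and> mset xs + mset (concat P) = mset_set {..<n}
     \<and> (\<Sum>p\<in>#mset P. path_edges p) = (\<Sum>p\<in>#mset es. path_edges p)"
proof -
  define zs where "zs = sorted_list_of_set ({..<n} - set (xs @ concat es))"
  have zs: "set zs = {..<n} - set (xs @ concat es)" "distinct zs" by (auto simp: zs_def)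
  have "card (set zs) \<le> n" using card_mono[of "{..<n}" "set zs"] zs(1) by simp
  then have "length zs \<le> n" using zs(2) by (simp only: distinct_card)
  define P where "P = es @ map (\<lambda>x. [x]) zs @ replicate (k - length es - length zs) []"
  have "mset (xs @ concat es @ zs) = mset_set (set (xs @ concat es @ zs))"
    using assms(1) zs by (intro mset_set_set[symmetric]) auto
  also have "set (xs @ concat es @ zs) = {..<n}" using zs(1) assms(2) by auto
  finally have "mset (xs @ concat es @ zs) = mset_set {..<n}" .
  moreover have "concat (map (\<lambda>x. [x]) zs) = zs" by (induction zs) auto
  ultimately have "mset xs + mset (concat P) = mset_set {..<n}"
    by (simp add: P_def add.assoc)
  moreover have "(\<Sum>p\<in>#mset P. path_edges p) = (\<Sum>p\<in>#mset es. path_edges p)"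
  proof -
    have "(\<Sum>p\<in>#mset (map (\<lambda>x. [x]) zs). path_edges p) = {#}" for zs :: "nat list" by (induction zs) auto
    moreover have "(\<Sum>p\<in>#mset (replicate r []). path_edges p) = {#}" for r by (induction r) auto
    ultimately show ?thesis unfolding P_def by (simp del: mset_map mset_replicate)
  qed
  moreover have "length P = k" using assms(3) \<open>length zs \<le> n\<close> by (simp add: P_def)
  ultimately show ?thesis by blast
qed

lemma exists_outline:
  assumes ls: "\<forall>l\<in>set ls. 3 \<le> l" and n: "10 * sum_list ls + 6 \<le> n" and \<delta>: "\<delta> \<le> 1"
  shows "\<exists>C P M. outline (mset ls) n \<delta> n (n + 1 + \<delta>) C P M"
proof -
  define h where "h = int (n div 2)"
  \<comment> \<open>Two elements of this upper half differ by less than \<open>n / 2\<close>. The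
    bound \<open>10 * sum_list ls + 6\<close> on \<open>n\<close> leaves it more than
    \<open>5 * sum_list ls + 1\<close> elements.\<close>
  define W where "W = {h + 1..<int n}"
  have n0: "0 < n" using n by simp
  have "card W = n - n div 2 - 1" unfolding W_def h_def by simp
  then have "5 * sum_list ls + 1 < card W" using n by linarith
  then obtain cs where cs: "map length cs = ls" "distinct (concat cs)" "set (concat cs) \<subseteq> W"
    "distinct (concat (map cycle_diffs cs))"
    using exists_cycles_distinct_diffs[of W ls] ls by (auto simp: W_def)
  have len: "3 \<le> length c" if "c \<in> set cs" for c using that ls by (auto simp flip: cs(1))
  define D where "D = set (concat (map cycle_diffs cs))"
  define T where "T = {d. 0 < d \<and> 2 * d < n}"
  have finT: "finite T" by (rule finite_subset[of _ "{..<n}"]) (auto simp: T_def)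
  have DT: "D \<subseteq> T"
  proof
    fix d assume "d \<in> D"
    then obtain c where c: "c \<in> set cs" "d \<in> set (cycle_diffs c)" by (auto simp: D_def)
    have "distinct c" using c cs(2) by (auto intro: distinct_concat_member)
    then obtain x y where xy: "x \<in> set c" "y \<in> set c" "x \<noteq> y" "d = nat \<bar>x - y\<bar>"
      using cycle_diffs_elem[OF c(2)] len[OF c(1)] by auto
    then have "x \<in> W" "y \<in> W" using c(1) cs(3) by auto
    then have "h + 1 \<le> x" "x < int n" "h + 1 \<le> y" "y < int n" by (auto simp: W_def)
    then have "0 < d" "2 * int d < int n" using xy(3,4) unfolding h_def by linarith+
    then show "d \<in> T" by (simp add: T_def)
  qed
  have "\<forall>d\<in>T - D. d \<le> (n - 1) div 2" "0 \<notin> T - D" "finite (T - D)" using finT by (auto simp: T_def)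
  then obtain p where p: "p \<noteq> []" "hd p = h" "distinct p" "set p \<subseteq> {h - int ((n - 1) div 2)..h}"
    "mset (path_diffs p) = mset_set (T - D)"
    using zigzag_path[of "T - D" "(n - 1) div 2" h] by blast
  \<comment> \<open>For even \<open>n\<close> the orbit of \<open>n / 2\<close> has only
    \<open>n / 2\<close> edges. They come from the edge between 0 and \<open>h\<close> put in front
    of the path in the first \<open>n / 2\<close> translates; for even \<open>n\<close> the path
    itself stays above 0.\<close>
  define q where "q i = (if even n \<and> i < n div 2 then 0 # p else p)" for i
  have q: "distinct (q i)" "set (q i) \<subseteq> {0..h}" for i
  proof -
    have "even n \<Longrightarrow> 0 < h - int ((n - 1) div 2)" using n0 unfolding h_def by presburger
    moreover have "0 \<le> h - int ((n - 1) div 2)" unfolding h_def by linarith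
    ultimately show "distinct (q i)" "set (q i) \<subseteq> {0..h}"
      using p(3,4) by (auto simp: q_def subset_iff h_def)
  qed
  define C where "C i = map (map (translate n i)) cs" for i
  have ears: "\<exists>P. length P = n + 1 + \<delta> \<and> mset (concat (C i)) + mset (concat P) = mset_set {..<n}
     \<and> (\<Sum>p\<in>#mset P. path_edges p) = (\<Sum>p\<in>#mset [map (translate n i) (q i)]. path_edges p)" for i
  proof (rule pad_ears)
    have eq: "concat (C i) @ concat [map (translate n i) (q i)] = map (translate n i) (concat cs @ q i)"
      by (simp add: C_def map_concat)
    have "h < int n" using n0 by (simp add: h_def)
    then have "set (concat cs @ q i) \<subseteq> {0..<int n}" using cs(3) q(2)[of i] by (auto simp: W_def h_def subset_iff)
    then have "inj_on (translate n i) (set (concat cs @ q i))" by (rule inj_on_subset[OF inj_translate])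
    moreover have "distinct (concat cs @ q i)" using cs(2,3) q[of i] by (fastforce simp: W_def)
    ultimately show "distinct (concat (C i) @ concat [map (translate n i) (q i)])"
      unfolding eq by (simp only: distinct_map)
    show "set (concat (C i) @ concat [map (translate n i) (q i)]) \<subseteq> {..<n}"
      unfolding eq using translate_less[OF n0] by auto
  qed simp
  then obtain P where P: "\<And>i. length (P i) = n + 1 + \<delta>"
    "\<And>i. mset (concat (C i)) + mset (concat (P i)) = mset_set {..<n}"
    "\<And>i. (\<Sum>p\<in>#mset (P i). path_edges p) = path_edges (map (translate n i) (q i))"
    by simp metis
  have "path_edges (map (translate n i) (q i)) = path_edges (map (translate n i) p)
      + (if even n \<and> i < n div 2 then {#{i, i + n div 2}#} else {#})" for i
  proof (cases "even n \<and> i < n div 2")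
    case True
    then have "translate n i 0 = i" "translate n i h = i + n div 2"
      by (auto simp: translate_def h_def nat_eq_iff)
    then show ?thesis using True p(1,2) by (cases p) (auto simp: q_def)
  qed (auto simp: q_def)
  then have "(\<Sum>i<n. path_edges (map (translate n i) (q i)))
     = (\<Sum>i<n. path_edges (map (translate n i) p))
      + (\<Sum>i<n. if even n \<and> i < n div 2 then {#{i, i + n div 2}#} else {#})"
    by (simp add: sum.distrib)
  also have "(\<Sum>i<n. path_edges (map (translate n i) p)) = (\<Sum>d\<in>T - D. orbit n d)"
    using sum_translate_path[OF n0, of p] p(5) by (simp add: sum_unfold_sum_mset)
  also have "(\<Sum>i<n. if even n \<and> i < n div 2 then {#{i, i + n div 2}#} else {#})
      = (if even n then (\<Sum>j<n div 2. {#{j, j + n div 2}#}) else {#})"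
    by (cases "even n") (auto intro!: sum.mono_neutral_cong_right split: if_splits)
  finally have paths: "(\<Sum>i<n. path_edges (map (translate n i) (q i))) = (\<Sum>d\<in>T - D. orbit n d)
      + (if even n then (\<Sum>j<n div 2. {#{j, j + n div 2}#}) else {#})" .
  have "mset (concat (map cycle_diffs cs)) = mset_set D"
    unfolding D_def using cs(4) by (rule mset_set_set[symmetric])
  moreover have "\<forall>c\<in>set cs. c \<noteq> []" using len by fastforce
  ultimately have cycles: "(\<Sum>i<n. \<Sum>c\<in>#mset (C i). closed_edges c) = (\<Sum>d\<in>D. orbit n d)"
    using sum_translate_cycles[OF n0, of cs] unfolding C_def by (simp add: sum_unfold_sum_mset)
  have "(\<Sum>i<n. (\<Sum>c\<in>#mset (C i). closed_edges c) + (\<Sum>p\<in>#mset (P i). path_edges p))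
     = (\<Sum>d\<in>D. orbit n d) + ((\<Sum>d\<in>T - D. orbit n d)
      + (if even n then (\<Sum>j<n div 2. {#{j, j + n div 2}#}) else {#}))"
    unfolding sum.distrib P(3) cycles paths ..
  also have "\<dots> = mset_set (complete_edges n)"
    using complete_edges_orbits[OF n0] sum.subset_diff[OF DT finT, of "orbit n"]
    by (simp add: T_def add_ac)
  finally have edges: "(\<Sum>i<n. (\<Sum>c\<in>#mset (C i). closed_edges c) + (\<Sum>p\<in>#mset (P i). path_edges p))
     = mset_set (complete_edges n)" .
  have lens: "mset (map length (C i)) = mset ls" for i
    unfolding C_def cs(1)[symmetric] by (simp add: comp_def)
  \<comment> \<open>The 1-factor starts empty. If it is present, then \<open>k = n + 2\<close>, so
    its \<open>n\<close> unmatched vertices satisfy both the bound and the parity condition.\<close>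
  have "unmatched n {#} = {..<n}" by (auto simp: unmatched_def)
  then have "outline (mset ls) n \<delta> n (n + 1 + \<delta>) C P (\<lambda>_. {#})"
    unfolding outline_def using edges P(1,2) lens \<delta> by (cases "\<delta> = 0") (auto simp: le_Suc_eq)
  then show ?thesis by blast
qed

text \<open>The assumption on \<open>y\<close> amounts to total order at least
  \<open>20 * sum_mset L + 14\<close>, which makes \<open>n = (v - 1) div 2\<close> at least
  \<open>10 * sum_mset L + 6\<close>. The remaining \<open>n + 1 + \<delta>\<close> vertices start
  out amalgamated.\<close>

lemma OP_solvable_long_cycle:
  assumes L: "\<forall>l\<in>#L. 3 \<le> l" and y: "19 * sum_mset L + 14 \<le> y"
  shows "OP_solvable (add_mset y L)"
proof -
  obtain ls where ls: "mset ls = L" using ex_mset by blast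
  define v where "v = sum_mset L + y"
  define n where "n = (v - 1) div 2"
  define \<delta> :: nat where "\<delta> = of_bool (even v)"
  have "1 \<le> v" using y by (simp add: v_def)
  then have v: "v = n + (n + 1 + \<delta>)"
    unfolding n_def \<delta>_def by (cases "even v") (simp_all, presburger+)
  have "10 * sum_list ls + 6 \<le> n"
    using y ls by (auto simp: n_def v_def simp flip: sum_mset_sum_list)
  moreover have "\<delta> \<le> 1" by (simp add: \<delta>_def)
  moreover have "\<forall>l\<in>set ls. 3 \<le> l" using L ls by auto
  ultimately obtain C P M where out: "outline L n \<delta> n (n + 1 + \<delta>) C P M"
    using exists_outline[of ls n \<delta>] ls by blast
  have "n + (n + 1 + \<delta>) - 1 = v - 1" using v by simp
  then obtain P' M' where out': "outline L n \<delta> (v - 1) 1 C P' M'"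
    using outline_detach_all[OF out L] by auto
  have "Suc (v - 1) = v" using \<open>1 \<le> v\<close> by simp
  then show ?thesis
    using y by (intro outline_close[OF out' L]) (simp_all add: v_def \<delta>_def)
qed

section \<open>Comparison with the stated bound\<close>

lemma sum_mset_le_mmax: "sum_mset A \<le> size A * mmax A"
proof -
  have "sum_mset A \<le> (\<Sum>a\<in>#A. mmax A)"
    using sum_mset_mono[of A "\<lambda>a. a" "\<lambda>_. mmax A"] by (auto simp: mmax_def)
  then show ?thesis by (simp add: mult.commute)
qed

theorem theorem1p1:
  fixes L :: "nat multiset" and y :: nat
  assumes "L \<noteq> {#}"
    and "\<forall>l \<in># L. 3 \<le> l"
    and "real y \<ge> 3 * real (sum_mset L)
          + 24 * (2 * real (size (filter_mset even L)) * (real (mmax (filter_mset even L)) + 3))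
          + 28 * ((7::real) powi (int (size (filter_mset odd L)) - 1)
                   * (2 * real (mmax (filter_mset odd L)) + 1))
          + 119"
  shows "OP_solvable (add_mset y L)"
proof (rule OP_solvable_long_cycle[OF assms(2)])
  define A where "A = filter_mset even L"
  define B where "B = filter_mset odd L"
  have sum: "sum_mset L = sum_mset A + sum_mset B"
    unfolding A_def B_def by (metis multiset_partition sum_mset.union)
  have "real (sum_mset A) \<le> real (size A) * real (mmax A)"
    using sum_mset_le_mmax[of A] by (metis of_nat_le_iff of_nat_mult)
  then have even_part: "real (sum_mset A) \<le> real (size A) * (real (mmax A) + 3)"
    by (simp add: distrib_left)
  \<comment> \<open>Without odd lengths the exponent is -1, and the right side is 1/7 while the sum
    is 0. Otherwise the power of 7 is at least the number of odd lengths.\<close>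
  have odd_part: "real (sum_mset B) \<le> 7 powi (int (size B) - 1) * (2 * real (mmax B) + 1)"
  proof (cases "size B")
    case (Suc r)
    have "real (Suc r) \<le> 7 ^ r" by (induction r) auto
    then have "real (Suc r) * real (mmax B) \<le> 7 ^ r * (2 * real (mmax B) + 1)"
      by (intro mult_mono) auto
    moreover have "real (sum_mset B) \<le> real (Suc r) * real (mmax B)"
      using sum_mset_le_mmax[of B] Suc by (metis of_nat_le_iff of_nat_mult)
    ultimately show ?thesis by (simp add: Suc)
  qed simp
  \<comment> \<open>The coefficients of the even and the odd lengths add up to 51 and 31, both above
    the 19 that is required.\<close>
  have "real y \<ge> 3 * real (sum_mset L) + 48 * real (sum_mset A) + 28 * real (sum_mset B) + 119"
    using assms(3) even_part odd_part unfolding A_def[symmetric] B_def[symmetric] by (simp add: algebra_simps)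
  then show "19 * sum_mset L + 14 \<le> y" using sum by linarith
qed

end
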